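(* When $n_{\mathrm{per}}=1$, we have $\mathbf{Z}_n^{(2)}\equiv\mathbf{0}$. When $n_{\mathrm{per}}\ge2$, we have $\mathbf{Z}_n^{(2)}\to\mathbf{0}$ almost surely as $n\to\infty$ if and only if $\sum_n r_n(1-r_n)=+\infty$.
   Context: Let $N\ge 2$, $V=\{1,\dots,N\}$, and let $W=[w_{l_1,l_2}]_{l_1,l_2\in V}$ be an irreducible real matrix with non-negative entries such that $W^\top\mathbf{1}=\mathbf{1}$, where $\mathbf{1}$ is the all-ones vector ($\mathbf{0}$ is the zero vector). Let $(r_n)_{n\ge0}$ be a deterministic sequence with $0<r_n<1$. Let $\mathbf{Z}_0=[Z_{0,1},\dots,Z_{0,N}]^\top$ be a random vector with values in $[0,1]^N$ such that $P(\mathbf{Z}_0=\mathbf{0})+P(\mathbf{Z}_0=\mathbf{1})<1$ and, for $n\ge 0$, let $\mathcal{F}_n=\sigma(Z_{0,l}:l\in V)\vee\sigma(X_{k,l}:1\le k\le n,\,l\in V)$. Given $\mathcal{F}_n$, the random variables $X_{n+1,l}$, $l\in V$, are $\{0,1\}$-valued and conditionally independent with $P(X_{n+1,l}=1\mid\mathcal{F}_n)=\sum_{l_1=1}^N w_{l_1,l}Z_{n,l_1}=[W^\top\mathbf{Z}_n]_l$, and $\mathbf{Z}_{n+1}=(1-r_n)\mathbf{Z}_n+r_n\mathbf{X}_{n+1}$, where $\mathbf{X}_{n}=[X_{n,1},\dots,X_{n,N}]^\top$, $\mathbf{Z}_{n}=[Z_{n,1},\dots,Z_{n,N}]^\top$.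 Let $n_{\mathrm{per}}\ge1$ be the period of the irreducible matrix $W^\top$ ($\gcd\{k\ge1:[(W^\top)^k]_{l,l}>0\}$, independent of $l$). The set $V$ is partitioned into $n_{\mathrm{per}}$ cyclic classes, numbered $0,\dots,n_{\mathrm{per}}-1$ (numbers modulo $n_{\mathrm{per}}$), such that $[W^\top]_{l_1,l_2}=0$ when $l_1$ is in class $h$ and $l_2$ is not in class $h+1$; they are the communicating classes of $(W^\top)^{n_{\mathrm{per}}}$. Write $l_1\sim_c l_2$ if $l_1,l_2$ are in the same cyclic class. Let $\mathbf{v}$ be the unique vector with strictly positive entries with $\mathbf{v}^\top W^\top=\mathbf{v}^\top$ and $\mathbf{v}^\top\mathbf{1}=1$. Set $\widetilde Z_n=\mathbf{v}^\top\mathbf{Z}_n$, $Z_{n,l}^{(C)}=\sum_{l_1\sim_c l}\frac{v_{l_1}}{\sum_{l_2\sim_c l}v_{l_2}}Z_{n,l_1}$ for $l\in V$, and $\mathbf{Z}_n^{(2)}=\mathbf{Z}_n^{(C)}-\widetilde Z_n\mathbf{1}$. *)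

theory Defs
  imports "HOL-Probability.Probability"
begin

text \<open>Powers with respect to the matrix product; the overloaded \<open>A ^ k\<close> on
  \<open>real ^ 'n ^ 'n\<close> would be the entrywise power.\<close>

primrec mat_pow :: "real ^ 'n ^ 'n \<Rightarrow> nat \<Rightarrow> real ^ 'n ^ 'n" where
  "mat_pow A 0 = mat 1"
| "mat_pow A (Suc k) = A ** mat_pow A k"

definition nonneg_mat :: "real ^ 'n ^ 'n \<Rightarrow> bool" where
  "nonneg_mat A \<longleftrightarrow> (\<forall>i j. 0 \<le> A $ i $ j)"

text \<open>Irreducibility in the usual form for matrices with non-negative entries.\<close>

definition irreducible_mat :: "real ^ 'n ^ 'n \<Rightarrow> bool" where
  "irreducible_mat A \<longleftrightarrow> (\<forall>i j. \<exists>k\<ge>1. 0 < mat_pow A k $ i $ j)"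

definition period_at :: "real ^ 'n ^ 'n \<Rightarrow> 'n \<Rightarrow> nat" where
  "period_at A i = Gcd {k. 1 \<le> k \<and> 0 < mat_pow A k $ i $ i}"

text \<open>The common value of the periods of the single indices; it exists for irreducible
  matrices, see \<open>period_eq_period_at\<close> below.\<close>

definition period :: "real ^ 'n ^ 'n \<Rightarrow> nat" where
  "period A = (THE d. \<forall>i. period_at A i = d)"

definition communicates :: "real ^ 'n ^ 'n \<Rightarrow> 'n \<Rightarrow> 'n \<Rightarrow> bool" where
  "communicates A i j \<longleftrightarrow>
     (\<exists>k. 0 < mat_pow A k $ i $ j) \<and> (\<exists>k. 0 < mat_pow A k $ j $ i)"

text \<open>The cyclic classes are the communicating classes of the power of \<open>A\<close> whose exponent is
  the period. By \<open>cyclic_numbering_classes\<close> below they are also the classes of every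
  numbering modulo the period along which \<open>A\<close> only leads from class \<open>h\<close> to class \<open>h + 1\<close>.\<close>

definition same_cyclic_class :: "real ^ 'n ^ 'n \<Rightarrow> 'n \<Rightarrow> 'n \<Rightarrow> bool" where
  "same_cyclic_class A = communicates (mat_pow A (period A))"

definition cyclic_numbering :: "real ^ 'n ^ 'n \<Rightarrow> ('n \<Rightarrow> nat) \<Rightarrow> bool" where
  "cyclic_numbering A c \<longleftrightarrow>
     c ` UNIV = {..<period A} \<and>
     (\<forall>i j. c j \<noteq> (c i + 1) mod period A \<longrightarrow> A $ i $ j = 0)"

text \<open>\<open>Z_tilde\<close>, \<open>Z_C\<close> and \<open>Z_2\<close> are taken as functions of the state \<open>z\<close>; \<open>A\<close> is the matrix
  whose cyclic classes are used and \<open>v\<close> its left eigenvector.\<close>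

definition Z_tilde :: "real ^ 'n \<Rightarrow> real ^ 'n \<Rightarrow> real" where
  "Z_tilde v z = v \<bullet> z"

definition Z_C :: "real ^ 'n ^ 'n \<Rightarrow> real ^ 'n \<Rightarrow> real ^ 'n \<Rightarrow> real ^ 'n" where
  "Z_C A v z = (\<chi> l. \<Sum>l1 | same_cyclic_class A l1 l.
     v $ l1 / (\<Sum>l2 | same_cyclic_class A l2 l. v $ l2) * z $ l1)"

definition Z_2 :: "real ^ 'n ^ 'n \<Rightarrow> real ^ 'n \<Rightarrow> real ^ 'n \<Rightarrow> real ^ 'n" where
  "Z_2 A v z = Z_C A v z - Z_tilde v z *\<^sub>R 1"

text \<open>The sigma-algebra generated by the entries of \<open>Z0\<close> and of \<open>X 1, \<dots>, X n\<close>;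
  \<open>X 0\<close> plays no role.\<close>

definition history ::
  "'a measure \<Rightarrow> ('a \<Rightarrow> real ^ 'n) \<Rightarrow> (nat \<Rightarrow> 'a \<Rightarrow> real ^ 'n) \<Rightarrow> nat \<Rightarrow> 'a measure" where
  "history M Z0 X n = sigma (space M)
     ({(\<lambda>\<omega>. Z0 \<omega> $ l) -` B \<inter> space M | l B. B \<in> sets borel} \<union>
      {(\<lambda>\<omega>. X k \<omega> $ l) -` B \<inter> space M | k l B. 1 \<le> k \<and> k \<le> n \<and> B \<in> sets borel})"

definition cprob :: "'a measure \<Rightarrow> 'a measure \<Rightarrow> 'a set \<Rightarrow> 'a \<Rightarrow> real" where
  "cprob M F S = real_cond_exp M F (indicator S)"

text \<open>Conditional independence given \<open>F\<close> of the finite family \<open>(Y l)\<close>; subfamilies are covered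
  by choosing \<open>B l = UNIV\<close> for the remaining indices.\<close>

definition cond_indep_vars ::
  "'a measure \<Rightarrow> 'a measure \<Rightarrow> ('n::finite \<Rightarrow> 'a \<Rightarrow> real) \<Rightarrow> bool" where
  "cond_indep_vars M F Y \<longleftrightarrow>
     (\<forall>B. (\<forall>l. B l \<in> sets borel) \<longrightarrow>
        (AE \<omega> in M. cprob M F {\<eta> \<in> space M. \<forall>l. Y l \<eta> \<in> B l} \<omega> =
                    (\<Prod>l\<in>UNIV. cprob M F {\<eta> \<in> space M. Y l \<eta> \<in> B l} \<omega>)))"


lemma mat_pow_add: "mat_pow A (m + n) = mat_pow A m ** mat_pow A n"
  by (induction m) (simp_all add: matrix_mul_assoc)

lemma mat_pow_mult: "mat_pow A (m * n) = mat_pow (mat_pow A m) n"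
  by (induction n) (simp_all add: mat_pow_add)

lemma mult_pos_iff:
  assumes "nonneg_mat A" "nonneg_mat B"
  shows "0 < (A ** B) $ i $ j \<longleftrightarrow> (\<exists>k. 0 < A $ i $ k \<and> 0 < B $ k $ j)"
proof -
  have nn: "0 \<le> A $ i $ k * B $ k $ j" for k
    using assms by (simp add: nonneg_mat_def)
  have "0 < (A ** B) $ i $ j \<longleftrightarrow> (A ** B) $ i $ j \<noteq> 0"
    using sum_nonneg[of UNIV "\<lambda>k. A $ i $ k * B $ k $ j"] nn
    by (auto simp: matrix_matrix_mult_def less_le)
  also have "\<dots> \<longleftrightarrow> (\<exists>k. A $ i $ k * B $ k $ j \<noteq> 0)"
    using nn by (simp add: matrix_matrix_mult_def sum_nonneg_eq_0_iff)
  also have "\<dots> \<longleftrightarrow> (\<exists>k. 0 < A $ i $ k \<and> 0 < B $ k $ j)"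
    using assms by (auto simp: nonneg_mat_def less_le)
  finally show ?thesis .
qed

lemma nonneg_mat_pow: "nonneg_mat A \<Longrightarrow> nonneg_mat (mat_pow A k)"
  by (induction k)
     (auto simp: nonneg_mat_def mat_def matrix_matrix_mult_def intro!: sum_nonneg)

lemma mat_pow_pos_trans:
  assumes "nonneg_mat A" "0 < mat_pow A m $ i $ k" "0 < mat_pow A n $ k $ j"
  shows "0 < mat_pow A (m + n) $ i $ j"
  unfolding mat_pow_add using assms by (auto simp: mult_pos_iff nonneg_mat_pow)

lemma period_at_dvd:
  assumes "nonneg_mat A" "irreducible_mat A"
  shows "period_at A j dvd period_at A i"
proof -
  obtain a b where a: "1 \<le> a" "0 < mat_pow A a $ i $ j" and b: "1 \<le> b" "0 < mat_pow A b $ j $ i"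
    using assms(2) by (meson irreducible_mat_def)
  have dvd: "period_at A j dvd k" if "1 \<le> k" "0 < mat_pow A k $ j $ j" for k
    unfolding period_at_def by (rule Gcd_dvd) (use that in simp)
  show ?thesis
    unfolding period_at_def[of A i]
  proof (rule Gcd_greatest)
    fix k assume "k \<in> {k. 1 \<le> k \<and> 0 < mat_pow A k $ i $ i}"
    then have "0 < mat_pow A (b + k + a) $ j $ j" "0 < mat_pow A (b + a) $ j $ j"
      using mat_pow_pos_trans[OF assms(1)] a b by blast+
    then have "period_at A j dvd b + k + a" "period_at A j dvd b + a"
      using dvd a b by simp_all
    then have "period_at A j dvd (b + a) + k" "period_at A j dvd b + a"
      by (simp_all add: ac_simps)
    then show "period_at A j dvd k"
      by (simp only: dvd_add_right_iff)
  qed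
qed

lemma period_eq_period_at:
  assumes "nonneg_mat A" "irreducible_mat A"
  shows "period A = period_at A i"
  unfolding period_def
proof (rule the_equality)
  show "\<forall>j. period_at A j = period_at A i"
    using period_at_dvd[OF assms] by (simp add: dvd_antisym)
qed simp

lemma cyclic_numbering_classes:
  assumes "nonneg_mat A" "irreducible_mat A" "cyclic_numbering A c"
  shows "same_cyclic_class A i j \<longleftrightarrow> c i = c j"
proof -
  define d where "d = period A"
  have lt: "c i < d" for i
    using assms(3) by (auto simp: cyclic_numbering_def d_def)
  have step: "c j = (c i + k) mod d" if "0 < mat_pow A k $ i $ j" for i j k
    using that
  proof (induction k arbitrary: i)
    case 0
    then show ?case using lt by (auto simp: mat_def split: if_splits)
  next
    case (Suc k)
    then obtain l where l: "0 < A $ i $ l" "0 < mat_pow A k $ l $ j"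
      using assms(1) by (auto simp: mult_pos_iff nonneg_mat_pow)
    then have "c l = (c i + 1) mod d"
      using assms(3) by (fastforce simp: cyclic_numbering_def d_def)
    then show ?case
      using Suc.IH[OF l(2)] by (simp add: mod_simps)
  qed
  have comm: "\<exists>m. 0 < mat_pow (mat_pow A d) m $ i $ j" if "c i = c j" for i j
  proof -
    obtain a where a: "0 < mat_pow A a $ i $ j"
      using assms(2) by (meson irreducible_mat_def)
    have "(c i + a) mod d = (c i + 0) mod d"
      using step[OF a] that lt by simp
    then have "d dvd a"
      by (metis add_diff_cancel_left' add_0_right le_add1 mod_eq_dvd_iff_nat)
    then show ?thesis
      using a by (metis dvdE mat_pow_mult)
  qed
  have "c i = c j" if "0 < mat_pow (mat_pow A d) m $ i $ j" for m
    using step[of "d * m" i j] that lt by (simp add: mat_pow_mult)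
  then show ?thesis
    using comm[of i j] comm[of j i]
    by (auto simp: same_cyclic_class_def communicates_def d_def)
qed

end

theory Submission
  imports Defs
begin

text \<open>
  Put \<open>A = transpose W\<close> and let \<open>d\<close> be its period. The deviations \<open>x h\<close> of the \<open>v\<close>-weighted
  class means from the overall mean \<open>v \<bullet> z\<close> satisfy \<open>x h (A *v z) = x (h + 1) z\<close>, so for the energy
  \<open>Q = (\<Sum>h<d. (x h)\<^sup>2)\<close> one gets
  \<open>E Q (n + 1) = E Q n - r n * (1 - r n) * E R n + e n\<close>, where \<open>R = (\<Sum>h<d. (x (h + 1) - x h)\<^sup>2)\<close>
  is comparable to \<open>Q\<close> and \<open>e n\<close> is \<open>(r n)\<^sup>2\<close> times a combination of the variances of the
  inclinations. Since \<open>v \<bullet> Z n\<close> is a bounded martingale and \<open>v\<close> is positive, \<open>e\<close> is always summable.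
  If the sum of \<open>r n * (1 - r n)\<close> diverges, \<open>E Q n\<close> therefore comes arbitrarily close to \<open>0\<close>, and a
  maximal inequality upgrades this to almost sure convergence. If it converges, \<open>E Q\<close> loses only a
  summable proportion in each step, and it is positive at some late time because the noise cannot
  vanish for a non-trivial initial state.
\<close>

subsection \<open>Cyclic classes\<close>

lemma mat_pow_transpose: "mat_pow (transpose A) k = transpose (mat_pow A k)"
proof (induction k)
  case (Suc k)
  have "transpose (mat_pow A (k + 1)) = transpose A ** transpose (mat_pow A k)"
    unfolding mat_pow_add by (simp add: matrix_transpose_mul)
  then show ?case
    using Suc by simp
qed (simp add: transpose_mat)

lemma irreducible_mat_transpose: "irreducible_mat A \<Longrightarrow> irreducible_mat (transpose A)"
  unfolding irreducible_mat_def mat_pow_transpose by (simp add: transpose_def)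

lemma nonneg_mat_transpose: "nonneg_mat A \<Longrightarrow> nonneg_mat (transpose A)"
  by (simp add: nonneg_mat_def transpose_def)

lemma period_pos:
  assumes "nonneg_mat A" "irreducible_mat A"
  shows "0 < period A"
proof -
  fix i
  obtain k where "1 \<le> k" "0 < mat_pow A k $ i $ i"
    using assms(2) by (meson irreducible_mat_def)
  moreover from this have "period_at A i dvd k"
    unfolding period_at_def by (intro Gcd_dvd) simp
  ultimately show ?thesis
    using period_eq_period_at[OF assms, of i] by (auto intro: Nat.gr0I)
qed

lemma period_dvd_loop:
  assumes "nonneg_mat A" "irreducible_mat A" "0 < mat_pow A k $ i $ i"
  shows "period A dvd k"
proof (cases "k = 0")
  case False
  then show ?thesis
    unfolding period_eq_period_at[OF assms(1,2), of i] period_at_def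
    using assms(3) by (intro Gcd_dvd) simp
qed simp

text \<open>A return path from \<open>j\<close> to \<open>i\<close> closes both paths to loops,
  whose lengths are multiples of the period; cancelling the return path leaves the
  congruence.\<close>

lemma path_lengths_cong:
  assumes "nonneg_mat A" "irreducible_mat A"
    and "0 < mat_pow A a $ i $ j" "0 < mat_pow A b $ i $ j"
  shows "a mod period A = b mod period A"
proof -
  obtain k where k: "0 < mat_pow A k $ j $ i"
    using assms(2) by (meson irreducible_mat_def)
  have "period A dvd a + k" "period A dvd b + k"
    using assms k mat_pow_pos_trans period_dvd_loop by blast+
  then have "(a + k) mod period A = (b + k) mod period A"
    by simp
  then show ?thesis
    by (simp add: nat_mod_eq_iff)
qed

lemma row_pos_entry:
  assumes "nonneg_mat A" "irreducible_mat A"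
  shows "\<exists>j. 0 < A $ i $ j"
proof -
  obtain k where "1 \<le> k" "0 < mat_pow A k $ i $ i"
    using assms(2) by (meson irreducible_mat_def)
  then show ?thesis
    using assms(1) by (cases k) (auto simp: mult_pos_iff nonneg_mat_pow)
qed

lemma column_pos_entry:
  assumes "nonneg_mat A" "irreducible_mat A"
  shows "\<exists>i. 0 < A $ i $ j"
proof -
  obtain k where k: "1 \<le> k" "0 < mat_pow A k $ j $ j"
    using assms(2) by (meson irreducible_mat_def)
  then have "mat_pow A k = mat_pow A (k - 1) ** A"
    using mat_pow_add[of A "k - 1" 1] by simp
  then show ?thesis
    using assms(1) k by (auto simp: mult_pos_iff nonneg_mat_pow)
qed

text \<open>An index gets the length, modulo the period, of any path to it from a fixed root. By
  \<open>path_lengths_cong\<close> the path does not matter, so one more edge raises the number by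
  one. All residues occur because every row has a positive entry along which to continue.\<close>

lemma ex_cyclic_numbering:
  fixes A :: "real ^ 'n ^ 'n"
  assumes "nonneg_mat A" "irreducible_mat A"
  shows "\<exists>c. cyclic_numbering A c"
proof -
  define d where "d = period A"
  have d: "0 < d"
    using period_pos[OF assms] by (simp add: d_def)
  fix i0 :: 'n
  have "\<forall>j. \<exists>k. 0 < mat_pow A k $ i0 $ j"
    using assms(2) by (meson irreducible_mat_def)
  then obtain len where len: "0 < mat_pow A (len j) $ i0 $ j" for j
    by metis
  define c where "c j = len j mod d" for j
  have c: "c j = k mod d" if "0 < mat_pow A k $ i0 $ j" for j k
    unfolding c_def d_def using path_lengths_cong[OF assms len that] .
  have step: "c j = (c i + 1) mod d" if "0 < A $ i $ j" for i j
  proof -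
    have "0 < mat_pow A (len i + 1) $ i0 $ j"
      by (rule mat_pow_pos_trans[OF assms(1) len]) (simp add: that)
    from c[OF this] show ?thesis
      by (simp add: c_def mod_simps)
  qed
  have "\<exists>j. c j = h mod d" for h
  proof (induction h)
    case 0
    have "c i0 = 0 mod d"
      by (rule c) (simp add: mat_def)
    then show ?case ..
  next
    case (Suc h)
    then obtain i where "c i = h mod d" ..
    moreover obtain j where "0 < A $ i $ j"
      using row_pos_entry[OF assms] ..
    ultimately have "c j = Suc h mod d"
      using step by (simp add: mod_simps)
    then show ?case ..
  qed
  then have "{..<d} \<subseteq> range c"
    by (metis lessThan_iff mod_less rangeI subsetI)
  moreover have "range c \<subseteq> {..<d}"
    using d by (auto simp: c_def)
  ultimately have "cyclic_numbering A c"
    using assms(1) step unfolding cyclic_numbering_def d_def[symmetric] nonneg_mat_def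
    by (metis antisym less_le)
  then show ?thesis
    by blast
qed

section \<open>Deviations of the weighted class means and their rotation under the matrix\<close>

locale stochastic_cycle =
  fixes A :: "real ^ 'n ^ 'n" and v :: "real ^ 'n" and c :: "'n \<Rightarrow> nat"
  assumes A_nonneg: "nonneg_mat A"
    and A_irreducible: "irreducible_mat A"
    and A_stochastic: "A *v 1 = 1"
    and v_pos: "0 < v $ l"
    and v_eigen: "v v* A = v"
    and v_sum: "v \<bullet> 1 = 1"
    and numbering: "cyclic_numbering A c"
begin

definition d :: nat where "d = period A"

text \<open>Every class has \<open>v\<close>-mass \<open>1 / d\<close>, so these are the weights of
  the mean over class \<open>h\<close> minus those of the overall mean. Reading \<open>h\<close>
  modulo \<open>d\<close> lets the next class be \<open>Suc h\<close> without wrap-around.\<close>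

definition \<gamma> :: "nat \<Rightarrow> 'n \<Rightarrow> real" where
  "\<gamma> h l = v $ l * (real d * of_bool (c l = h mod d) - 1)"

text \<open>These turn out to be the entries of \<open>Z_2\<close>, see \<open>Z_2_nth\<close>. The
  form of a weighted sum allows \<open>second_moment_step\<close> to be applied with
  \<open>u = \<gamma> h\<close>.\<close>

definition cdev :: "nat \<Rightarrow> real ^ 'n \<Rightarrow> real" where
  "cdev h z = (\<Sum>l\<in>UNIV. \<gamma> h l * z $ l)"

lemma d_pos: "0 < d"
  unfolding d_def by (rule period_pos[OF A_nonneg A_irreducible])

lemma c_less: "c l < d"
  using numbering by (auto simp: cyclic_numbering_def d_def)

lemma row_sum: "(\<Sum>j\<in>UNIV. A $ i $ j) = 1"
  using A_stochastic by (simp add: vec_eq_iff matrix_vector_mult_def)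

lemma A_entry_nonneg: "0 \<le> A $ i $ j"
  using A_nonneg by (simp add: nonneg_mat_def)

lemma left_eigen: "(\<Sum>i\<in>UNIV. v $ i * A $ i $ j) = v $ j"
  using v_eigen by (simp add: vec_eq_iff vector_matrix_mult_def mult.commute)

lemma sum_v: "(\<Sum>l\<in>UNIV. v $ l) = 1"
  using v_sum by (simp add: inner_vec_def)

lemma sum_v_mult: "(\<Sum>i\<in>UNIV. v $ i * (A *v z) $ i) = (\<Sum>j\<in>UNIV. v $ j * z $ j)"
proof -
  have "(\<Sum>i\<in>UNIV. v $ i * (A *v z) $ i) = (\<Sum>i\<in>UNIV. \<Sum>j\<in>UNIV. v $ i * A $ i $ j * z $ j)"
    by (simp add: matrix_vector_mult_def sum_distrib_left mult.assoc)
  also have "\<dots> = (\<Sum>j\<in>UNIV. \<Sum>i\<in>UNIV. v $ i * A $ i $ j * z $ j)"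
    by (rule sum.swap)
  also have "\<dots> = (\<Sum>j\<in>UNIV. v $ j * z $ j)"
    by (simp add: left_eigen flip: sum_distrib_right)
  finally show ?thesis .
qed

lemma class_step:
  assumes "A $ i $ j \<noteq> 0"
  shows "c i = h mod d \<longleftrightarrow> c j = Suc h mod d"
proof -
  have "c j = (c i + 1) mod d"
    using numbering assms by (auto simp: cyclic_numbering_def d_def)
  moreover have "(c i + 1) mod d = (h + 1) mod d \<longleftrightarrow> c i mod d = h mod d"
    by (auto simp: nat_mod_eq_iff)
  ultimately show ?thesis
    using c_less[of i] by simp
qed

text \<open>Non-zero entries lead from class \<open>h\<close> only into class \<open>h + 1\<close>,
  so the class indicator can be moved from the row index to the column index, after which the left
  eigenvector \<open>v\<close> absorbs \<open>A\<close>.\<close>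

lemma class_sum_mult:
  "(\<Sum>i\<in>UNIV. v $ i * of_bool (c i = h mod d) * (A *v z) $ i) =
   (\<Sum>j\<in>UNIV. v $ j * of_bool (c j = Suc h mod d) * z $ j)"
proof -
  have "(\<Sum>i\<in>UNIV. v $ i * of_bool (c i = h mod d) * (A *v z) $ i) =
      (\<Sum>i\<in>UNIV. \<Sum>j\<in>UNIV. v $ i * of_bool (c i = h mod d) * A $ i $ j * z $ j)"
    by (simp add: matrix_vector_mult_def sum_distrib_left mult.assoc)
  also have "\<dots> = (\<Sum>i\<in>UNIV. \<Sum>j\<in>UNIV. v $ i * A $ i $ j * (of_bool (c j = Suc h mod d) * z $ j))"
    using class_step by (intro sum.cong) (auto simp: of_bool_def)
  also have "\<dots> = (\<Sum>j\<in>UNIV. \<Sum>i\<in>UNIV. v $ i * A $ i $ j * (of_bool (c j = Suc h mod d) * z $ j))"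
    by (rule sum.swap)
  also have "\<dots> = (\<Sum>j\<in>UNIV. v $ j * (of_bool (c j = Suc h mod d) * z $ j))"
    by (simp add: left_eigen flip: sum_distrib_right)
  finally show ?thesis by (simp add: mult.assoc)
qed

lemma sum_periodic_shift:
  fixes f :: "nat \<Rightarrow> real"
  assumes "f d = f 0"
  shows "(\<Sum>h<d. f (Suc h)) = (\<Sum>h<d. f h)"
  using sum.lessThan_Suc_shift[of f d] assms by simp

text \<open>Taking \<open>z = 1\<close> in \<open>class_sum_mult\<close> shows that consecutive
  classes have equal mass, and the \<open>d\<close> masses add up to 1.\<close>

lemma class_mass: "(\<Sum>l\<in>UNIV. v $ l * of_bool (c l = h mod d)) = 1 / d"
proof -
  define m where "m h = (\<Sum>l\<in>UNIV. v $ l * of_bool (c l = h mod d))" for h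
  have "m (Suc h) = m h" for h
    using class_sum_mult[of h 1] by (simp add: m_def A_stochastic)
  then have const: "m h = m 0" for h
    by (induction h) auto
  have "(\<Sum>h<d. m h) = (\<Sum>l\<in>UNIV. \<Sum>h<d. v $ l * of_bool (c l = h mod d))"
    unfolding m_def by (rule sum.swap)
  also have "\<dots> = (\<Sum>l\<in>UNIV. \<Sum>h<d. if h = c l then v $ l else 0)"
    by (intro sum.cong) auto
  also have "\<dots> = 1"
    using c_less by (simp add: sum_v)
  finally have "(\<Sum>h<d. m h) = 1" .
  moreover have "(\<Sum>k<d. m k) = (\<Sum>k<d. m h)"
    by (rule sum.cong[OF refl]) (metis const)
  ultimately have "d * m h = 1"
    by simp
  then show ?thesis
    using d_pos by (simp add: m_def field_simps)
qed

lemma cdev_alt: "cdev h z = d * (\<Sum>l\<in>UNIV. v $ l * of_bool (c l = h mod d) * z $ l)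
    - (\<Sum>l\<in>UNIV. v $ l * z $ l)"
  unfolding cdev_def \<gamma>_def sum_distrib_left sum_subtractf[symmetric]
  by (intro sum.cong) (auto simp: algebra_simps)

text \<open>One application of \<open>A\<close> rotates the class means and preserves the overall
  mean, so on the deviations the mean dynamics is a smoothing along a cycle of length
  \<open>d\<close>.\<close>

lemma cdev_mult: "cdev h (A *v z) = cdev (Suc h) z"
  unfolding cdev_alt by (simp only: class_sum_mult sum_v_mult)

lemma \<gamma>_periodic: "\<gamma> (h + d) = \<gamma> h" 
  by (simp add: \<gamma>_def fun_eq_iff)

lemma cdev_d: "cdev d z = cdev 0 z"
  using \<gamma>_periodic[of 0] by (simp add: cdev_def)

lemma sum_cdev: "(\<Sum>h<d. cdev h z) = 0"
proof -
  have "(\<Sum>h<d. \<Sum>l\<in>UNIV. v $ l * of_bool (c l = h mod d) * z $ l) =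
      (\<Sum>l\<in>UNIV. \<Sum>h<d. v $ l * of_bool (c l = h mod d) * z $ l)"
    by (rule sum.swap)
  also have "\<dots> = (\<Sum>l\<in>UNIV. \<Sum>h<d. if h = c l then v $ l * z $ l else 0)"
    by (intro sum.cong) auto
  also have "\<dots> = (\<Sum>l\<in>UNIV. v $ l * z $ l)"
    using c_less by simp
  finally show ?thesis
    by (simp add: cdev_alt sum_subtractf flip: sum_distrib_left)
qed

text \<open>The normalising constant in \<open>Z_C\<close> is \<open>1 / d\<close> by
  \<open>class_mass\<close>, which turns the class mean into \<open>d\<close> times a class
  sum.\<close>

lemma Z_2_nth: "Z_2 A v z $ l = cdev (c l) z"
proof -
  have cls: "{k. same_cyclic_class A k l} = {k. c k = c l mod d}"
    using cyclic_numbering_classes[OF A_nonneg A_irreducible numbering] c_less by simp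
  have mass: "(\<Sum>k | c k = c l mod d. v $ k) = 1 / d"
    using class_mass[of "c l"] by (simp add: of_bool_def if_distrib sum.If_cases cong: if_cong)
  have "Z_C A v z $ l = (\<Sum>k | c k = c l mod d. d * (v $ k * z $ k))"
    by (simp add: Z_C_def cls mass mult_ac)
  also have "\<dots> = d * (\<Sum>k\<in>UNIV. v $ k * of_bool (c k = c l mod d) * z $ k)"
    unfolding sum_distrib_left
    by (intro sum.mono_neutral_cong_left) auto
  finally show ?thesis
    by (simp add: Z_2_def cdev_alt Z_tilde_def inner_vec_def)
qed

lemma cdev_affine: "cdev h (a *\<^sub>R y + b *\<^sub>R z) = a * cdev h y + b * cdev h z"
  by (simp add: cdev_def sum_distrib_left sum.distrib algebra_simps)

lemma cdev_mix: "cdev h ((1 - s) *\<^sub>R z + s *\<^sub>R (A *v z)) = (1 - s) * cdev h z + s * cdev (Suc h) z"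
  by (simp add: cdev_affine cdev_mult)

section \<open>Energy of the deviations, its dissipation along the cycle, and extremal
  states\<close>

definition Q :: "real ^ 'n \<Rightarrow> real" where
  "Q z = (\<Sum>h<d. (cdev h z)\<^sup>2)"

definition R :: "real ^ 'n \<Rightarrow> real" where
  "R z = (\<Sum>h<d. (cdev (Suc h) z - cdev h z)\<^sup>2)"

lemma Q_nonneg: "0 \<le> Q z"
  by (simp add: Q_def sum_nonneg)

lemma R_nonneg: "0 \<le> R z"
  by (simp add: R_def sum_nonneg)

lemma Q_shift: "(\<Sum>h<d. (cdev (Suc h) z)\<^sup>2) = Q z"
  unfolding Q_def by (rule sum_periodic_shift) (simp add: cdev_d)

text \<open>With two classes or more, some class misses \<open>l\<close>, and there the weight is
  \<open>- v $ l\<close>. Hence noise at any index feeds the energy.\<close>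

lemma \<gamma>_nonzero:
  assumes "2 \<le> d"
  shows "\<exists>h<d. \<gamma> h l \<noteq> 0"
proof -
  obtain h where "h < d" "c l \<noteq> h"
    using assms by (metis less_le_trans one_less_numeral_iff pos2 semiring_norm(76) zero_neq_one)
  then show ?thesis
    using v_pos[of l] by (intro exI[of _ h]) (auto simp: \<gamma>_def)
qed

text \<open>Each entry of \<open>A *v z\<close> is a convex combination of entries of
  \<open>z\<close>; it is extremal only if all entries of positive weight are. Every
  \<open>j\<close> has positive weight in some row.\<close>

lemma binary_of_binary_mult:
  assumes z: "\<And>j. 0 \<le> z $ j \<and> z $ j \<le> 1" and bin: "\<And>i. (A *v z) $ i = 0 \<or> (A *v z) $ i = 1"
  shows "z $ j = 0 \<or> z $ j = 1"
proof -
  obtain i where pos: "0 < A $ i $ j"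
    using column_pos_entry[OF A_nonneg A_irreducible] by blast
  have nn: "0 \<le> A $ i $ k * z $ k" "0 \<le> A $ i $ k * (1 - z $ k)" for k
    using z[of k] A_entry_nonneg[of i k] by auto
  have "(\<Sum>k\<in>UNIV. A $ i $ k * (1 - z $ k)) = 1 - (A *v z) $ i"
    by (simp add: right_diff_distrib sum_subtractf row_sum matrix_vector_mult_def)
  moreover have "(A *v z) $ i = (\<Sum>k\<in>UNIV. A $ i $ k * z $ k)"
    by (simp add: matrix_vector_mult_def)
  ultimately have "(\<Sum>k\<in>UNIV. A $ i $ k * z $ k) = 0 \<or> (\<Sum>k\<in>UNIV. A $ i $ k * (1 - z $ k)) = 0"
    using bin[of i] by auto
  then have "A $ i $ j * z $ j = 0 \<or> A $ i $ j * (1 - z $ j) = 0"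
    using nn by (auto simp: sum_nonneg_eq_0_iff)
  then show ?thesis
    using pos by auto
qed

text \<open>A zero at \<open>i\<close> spreads: \<open>z\<close> is fixed by all powers of
  \<open>A\<close>, a sum of non-negative terms vanishes at \<open>i\<close>, and irreducibility
  gives every \<open>j\<close> positive weight in one of these sums.\<close>

lemma binary_fixpoint_const:
  assumes bin: "\<And>j. z $ j = 0 \<or> z $ j = 1" and fixp: "A *v z = z"
  shows "z = 0 \<or> z = 1"
proof (cases "\<exists>i. z $ i = 0")
  case True
  then obtain i where i: "z $ i = 0" ..
  have pow: "mat_pow A k *v z = z" for k
    by (induction k) (simp_all add: fixp flip: matrix_vector_mul_assoc)
  have "z $ j = 0" for j
  proof -
    obtain k where k: "0 < mat_pow A k $ i $ j"
      using A_irreducible by (meson irreducible_mat_def)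
    have "0 \<le> mat_pow A k $ i $ l * z $ l" for l
      using nonneg_mat_pow[OF A_nonneg, of k] bin[of l] by (auto simp: nonneg_mat_def)
    moreover have "(\<Sum>l\<in>UNIV. mat_pow A k $ i $ l * z $ l) = 0"
      using pow[of k] i by (simp add: vec_eq_iff matrix_vector_mult_def)
    ultimately have "mat_pow A k $ i $ j * z $ j = 0"
      by (simp add: sum_nonneg_eq_0_iff)
    then show ?thesis
      using k by simp
  qed
  then show ?thesis
    by (simp add: vec_eq_iff)
next
  case False
  then show ?thesis
    using bin by (simp add: vec_eq_iff)
qed

text \<open>The defect in the convexity of the square is
  \<open>s * (1 - s) * (y - x)\<^sup>2\<close>; the two remaining sums of squares are both
  \<open>Q z\<close>, since a cyclic shift does not change the energy.\<close>

lemma Q_mix: "(\<Sum>h<d. ((1 - s) * cdev h z + s * cdev (Suc h) z)\<^sup>2) = Q z - s * (1 - s) * R z"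
proof -
  have "((1 - s) * x + s * y)\<^sup>2 = (1 - s) * x\<^sup>2 + s * y\<^sup>2 - s * (1 - s) * (y - x)\<^sup>2" for x y :: real
    by (simp add: power2_eq_square algebra_simps)
  then have "(\<Sum>h<d. ((1 - s) * cdev h z + s * cdev (Suc h) z)\<^sup>2) =
      (1 - s) * Q z + s * (\<Sum>h<d. (cdev (Suc h) z)\<^sup>2) - s * (1 - s) * R z"
    by (simp add: Q_def R_def sum.distrib sum_subtractf sum_distrib_left)
  then show ?thesis
    by (simp add: Q_shift algebra_simps)
qed

text \<open>Bounds the energy lost in one step from above, which the case of a convergent sum
  requires; \<open>Q_le_R\<close> is the counterpart for the divergent one.\<close>

lemma R_le: "R z \<le> 4 * Q z"
proof -
  have "(y - x)\<^sup>2 \<le> 2 * y\<^sup>2 + 2 * x\<^sup>2" for x y :: real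
    using zero_le_power2[of "x + y"] by (simp add: power2_eq_square algebra_simps)
  then have "R z \<le> (\<Sum>h<d. 2 * (cdev (Suc h) z)\<^sup>2 + 2 * (cdev h z)\<^sup>2)"
    unfolding R_def by (intro sum_mono)
  also have "\<dots> = 4 * Q z"
    using Q_shift[of z] by (simp add: sum.distrib Q_def flip: sum_distrib_left)
  finally show ?thesis .
qed

text \<open>A discrete Poincare inequality on the cycle: the deviations have mean zero, so each of
  them is at most the total variation along the cycle.\<close>

lemma Q_le_R: "Q z \<le> d\<^sup>2 * R z"
proof -
  define T where "T = (\<Sum>k<d. \<bar>cdev (Suc k) z - cdev k z\<bar>)"
  have diff_le: "\<bar>cdev h z - cdev g z\<bar> \<le> T" if "g \<le> h" "h < d" for g h
  proof -
    have "\<bar>cdev h z - cdev g z\<bar> = \<bar>\<Sum>k = g..<h. cdev (Suc k) z - cdev k z\<bar>"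
      using sum_Suc_diff'[OF that(1), of "\<lambda>k. cdev k z"] by simp
    also have "\<dots> \<le> (\<Sum>k = g..<h. \<bar>cdev (Suc k) z - cdev k z\<bar>)"
      by (rule sum_abs)
    also have "\<dots> \<le> T"
      unfolding T_def by (rule sum_mono2) (use that in auto)
    finally show ?thesis .
  qed
  have dev_le: "\<bar>cdev h z\<bar> \<le> T" if "h < d" for h
  proof -
    have "\<bar>cdev h z - cdev g z\<bar> \<le> T" if "g < d" for g
      using diff_le[of g h] diff_le[of h g] \<open>h < d\<close> that by (cases "g \<le> h") (auto simp: abs_minus_commute)
    then have "\<bar>\<Sum>g<d. cdev h z - cdev g z\<bar> \<le> d * T"
      using order_trans[OF sum_abs sum_bounded_above[of "{..<d}" "\<lambda>g. \<bar>cdev h z - cdev g z\<bar>" T]]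
      by simp
    then have "d * \<bar>cdev h z\<bar> \<le> d * T"
      by (simp add: sum_subtractf sum_cdev abs_mult)
    then show ?thesis
      using d_pos by simp
  qed
  \<comment> \<open>Cauchy-Schwarz against the constant 1 costs one factor \<open>d\<close>; the
    summation over \<open>h\<close> below costs the other.\<close>
  have "T\<^sup>2 \<le> (\<Sum>k<d. (1::real)\<^sup>2) * (\<Sum>k<d. \<bar>cdev (Suc k) z - cdev k z\<bar>\<^sup>2)"
    unfolding T_def using Cauchy_Schwarz_ineq_sum[of "\<lambda>_. 1" "\<lambda>k. \<bar>cdev (Suc k) z - cdev k z\<bar>" "{..<d}"] by simp
  then have T: "T\<^sup>2 \<le> d * R z"
    by (simp add: R_def)
  have "Q z \<le> (\<Sum>h<d. T\<^sup>2)"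
    unfolding Q_def
  proof (rule sum_mono)
    fix h assume "h \<in> {..<d}"
    then have "\<bar>cdev h z\<bar>\<^sup>2 \<le> T\<^sup>2"
      using dev_le by (intro power_mono) auto
    then show "(cdev h z)\<^sup>2 \<le> T\<^sup>2"
      by simp
  qed
  also have "\<dots> \<le> d * (d * R z)"
    using T by (simp add: mult_left_mono)
  finally show ?thesis
    by (simp add: power2_eq_square mult.assoc)
qed

text \<open>Every class is inhabited, so convergence of the entries controls each summand of
  \<open>Q\<close>; conversely the square of each entry is one of these summands.\<close>

lemma tendsto_Z_2_iff:
  "(\<lambda>n. Z_2 A v (z n)) \<longlonglongrightarrow> 0 \<longleftrightarrow> (\<lambda>n. Q (z n)) \<longlonglongrightarrow> 0"
proof
  assume lim: "(\<lambda>n. Z_2 A v (z n)) \<longlonglongrightarrow> 0"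
  have "(\<lambda>n. (cdev h (z n))\<^sup>2) \<longlonglongrightarrow> 0" if "h < d" for h
  proof -
    obtain l where "c l = h"
      using numbering \<open>h < d\<close> unfolding cyclic_numbering_def d_def by (metis imageE lessThan_iff)
    then have "(\<lambda>n. cdev h (z n)) \<longlonglongrightarrow> 0"
      using tendsto_vec_nth[OF lim, of l] by (simp add: Z_2_nth)
    from tendsto_power[OF this, of 2] show ?thesis
      by simp
  qed
  then show "(\<lambda>n. Q (z n)) \<longlonglongrightarrow> 0"
    unfolding Q_def by (intro tendsto_null_sum) simp
next
  assume lim: "(\<lambda>n. Q (z n)) \<longlonglongrightarrow> 0"
  have "(\<lambda>n. cdev (c l) (z n)) \<longlonglongrightarrow> 0" for l
  proof -
    have "(\<lambda>n. (cdev (c l) (z n))\<^sup>2) \<longlonglongrightarrow> 0"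
    proof (rule tendsto_sandwich[OF _ _ tendsto_const lim])
      show "\<forall>\<^sub>F n in sequentially. (cdev (c l) (z n))\<^sup>2 \<le> Q (z n)"
        unfolding Q_def using c_less by (intro always_eventually allI member_le_sum) auto
    qed simp
    then show ?thesis
      using tendsto_real_sqrt[of "\<lambda>n. (cdev (c l) (z n))\<^sup>2"] by (simp add: tendsto_rabs_zero_iff)
  qed
  then show "(\<lambda>n. Z_2 A v (z n)) \<longlonglongrightarrow> 0"
    by (intro vec_tendstoI) (simp add: Z_2_nth)
qed

end

subsection \<open>Almost supermartingales\<close>

definition bounded_rv :: "'a measure \<Rightarrow> ('a \<Rightarrow> real) set" where
  "bounded_rv N = {f \<in> borel_measurable N. \<exists>B. \<forall>x\<in>space N. \<bar>f x\<bar> \<le> B}"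

lemma bounded_rvI:
  assumes "f \<in> borel_measurable N" "\<And>x. x \<in> space N \<Longrightarrow> \<bar>f x\<bar> \<le> B"
  shows "f \<in> bounded_rv N"
  using assms by (auto simp: bounded_rv_def)

lemma bounded_rv_measurable: "f \<in> bounded_rv N \<Longrightarrow> f \<in> borel_measurable N"
  by (simp add: bounded_rv_def)

lemma bounded_rv_const: "(\<lambda>_. a) \<in> bounded_rv N"
  by (auto simp: bounded_rv_def)

lemma bounded_rv_indicator: "S \<in> sets N \<Longrightarrow> indicator S \<in> bounded_rv N"
  by (rule bounded_rvI[of _ _ 1]) (auto simp: indicator_def)

lemma bounded_rv_add:
  assumes "f \<in> bounded_rv N" "g \<in> bounded_rv N"
  shows "(\<lambda>x. f x + g x) \<in> bounded_rv N"
proof -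
  obtain B C where "\<forall>x\<in>space N. \<bar>f x\<bar> \<le> B" "\<forall>x\<in>space N. \<bar>g x\<bar> \<le> C"
    using assms by (auto simp: bounded_rv_def)
  then have "\<forall>x\<in>space N. \<bar>f x + g x\<bar> \<le> B + C"
    by (meson abs_triangle_ineq add_mono order_trans)
  then show ?thesis
    using assms by (auto simp: bounded_rv_def)
qed

lemma bounded_rv_mult:
  assumes "f \<in> bounded_rv N" "g \<in> bounded_rv N"
  shows "(\<lambda>x. f x * g x) \<in> bounded_rv N"
proof -
  obtain B C where "\<forall>x\<in>space N. \<bar>f x\<bar> \<le> B" "\<forall>x\<in>space N. \<bar>g x\<bar> \<le> C"
    using assms by (auto simp: bounded_rv_def)
  then have "\<forall>x\<in>space N. \<bar>f x * g x\<bar> \<le> B * C"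
    by (simp add: abs_mult mult_mono')
  then show ?thesis
    using assms by (auto simp: bounded_rv_def)
qed

lemma bounded_rv_diff:
  assumes "f \<in> bounded_rv N" "g \<in> bounded_rv N"
  shows "(\<lambda>x. f x - g x) \<in> bounded_rv N"
  using bounded_rv_add[OF assms(1) bounded_rv_mult[OF bounded_rv_const[of "-1"] assms(2)]] by simp

lemma bounded_rv_power2:
  "f \<in> bounded_rv N \<Longrightarrow> (\<lambda>x. (f x)\<^sup>2) \<in> bounded_rv N"
  unfolding power2_eq_square by (rule bounded_rv_mult)

lemma bounded_rv_sum:
  assumes "\<And>i. i \<in> I \<Longrightarrow> f i \<in> bounded_rv N"
  shows "(\<lambda>x. \<Sum>i\<in>I. f i x) \<in> bounded_rv N"
  using assms
proof (induction I rule: infinite_finite_induct)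
  case (insert i I)
  then show ?case
    using bounded_rv_add[of "f i" N "\<lambda>x. \<Sum>i\<in>I. f i x"] by simp
qed (simp_all add: bounded_rv_const)

lemmas bounded_rv_intros = bounded_rv_const bounded_rv_indicator bounded_rv_add bounded_rv_diff
  bounded_rv_mult bounded_rv_power2 bounded_rv_sum

lemma bounded_rv_subalgebra:
  assumes "subalgebra M F" "f \<in> bounded_rv F"
  shows "f \<in> bounded_rv M"
  using assms measurable_from_subalg[OF assms(1)] by (auto simp: bounded_rv_def subalgebra_def)

lemma bounded_rv_cong:
  assumes "\<And>x. x \<in> space N \<Longrightarrow> f x = g x"
  shows "f \<in> bounded_rv N \<longleftrightarrow> g \<in> bounded_rv N"
  using assms measurable_cong[of N f g borel] by (auto simp: bounded_rv_def)

lemma (in finite_measure) integrable_bounded_rv: "f \<in> bounded_rv M \<Longrightarrow> integrable M f"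
proof -
  assume "f \<in> bounded_rv M"
  then obtain B where "f \<in> borel_measurable M" "\<forall>x\<in>space M. \<bar>f x\<bar> \<le> B"
    unfolding bounded_rv_def by blast
  then show ?thesis
    by (intro integrable_const_bound[of f B]) auto
qed

lemma (in finite_measure) integral_add3:
  assumes "f \<in> bounded_rv M" "g \<in> bounded_rv M" "h \<in> bounded_rv M"
  shows "(\<integral>x. f x + g x + h x \<partial>M) = (\<integral>x. f x \<partial>M) + (\<integral>x. g x \<partial>M) + (\<integral>x. h x \<partial>M)"
  using assms[THEN integrable_bounded_rv] by simp

lemma borel_measurable_vec_nth: "(\<lambda>x::real ^ 'n. x $ l) \<in> borel_measurable borel"
  by (intro borel_measurable_continuous_onI continuous_intros)

lemma filterlim_sum_at_top_of_not_summable: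
  fixes f :: "nat \<Rightarrow> real"
  assumes nonneg: "\<And>n. 0 \<le> f n" and "\<not> summable f"
  shows "filterlim (\<lambda>n. \<Sum>k<n. f k) at_top sequentially"
  unfolding filterlim_at_top
proof
  fix C
  obtain m where m: "C < (\<Sum>k<m. f k)"
    using summableI_nonneg_bounded[of f C] assms by (meson not_le)
  have "C \<le> (\<Sum>k<n. f k)" if "m \<le> n" for n
    using m sum_mono2[of "{..<n}" "{..<m}" f] nonneg that by fastforce
  then show "\<forall>\<^sub>F n in sequentially. C \<le> (\<Sum>k<n. f k)"
    unfolding eventually_sequentially by blast
qed

text \<open>A strict convex combination of two points of the unit interval is an endpoint only if
  both points are that endpoint.\<close>

lemma convex_comb_binary:
  fixes s x y :: real
  assumes "0 < s" "s < 1" "0 \<le> x" "x \<le> 1" "y = 0 \<or> y = 1" and w: "w = (1 - s) * x + s * y" "w = 0 \<or> w = 1"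
  shows "x = w" "y = w"
proof -
  have "x = w \<and> y = w"
  proof (cases "y = 0")
    case True
    have "(1 - s) * x < 1"
      using assms mult_left_le[of x "1 - s"] by linarith
    then have "(1 - s) * x = 0"
      using w True by auto
    then show ?thesis
      using w True assms by auto
  next
    case False
    then have y: "y = 1"
      using assms by simp
    have "0 \<le> (1 - s) * x"
      using assms by simp
    moreover have "w = (1 - s) * x + s"
      using w(1) y by simp
    ultimately have "w = 1"
      using w(2) \<open>0 < s\<close> by linarith
    then have "(1 - s) * (1 - x) = 0"
      using w y by (simp add: algebra_simps)
    then show ?thesis
      using assms y \<open>w = 1\<close> by auto
  qed
  then show "x = w" "y = w" by auto
qed

text \<open>The usual maximal inequality for non-negative supermartingales, with an additive error;
  the time of first passage above \<open>\<epsilon>\<close> is encoded in the events that it has not yet occurred.\<close>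

lemma (in prob_space) maximal_inequality:
  fixes Y :: "nat \<Rightarrow> 'a \<Rightarrow> real"
  assumes sub: "\<And>n. subalgebra M (F n)" and mono: "\<And>n. sets (F n) \<subseteq> sets (F (Suc n))"
    and Y: "\<And>n. Y n \<in> borel_measurable (F n)" "\<And>n. integrable M (Y n)"
    and nonneg: "\<And>n \<omega>. \<omega> \<in> space M \<Longrightarrow> 0 \<le> Y n \<omega>"
    and step: "\<And>n S. S \<in> sets (F n) \<Longrightarrow>
      (\<integral>\<omega>. indicator S \<omega> * Y (Suc n) \<omega> \<partial>M) \<le> (\<integral>\<omega>. indicator S \<omega> * Y n \<omega> \<partial>M) + e n"
    and eps: "0 < \<epsilon>"
  shows "\<epsilon> * prob {\<omega> \<in> space M. \<exists>k\<in>{m..m + n}. \<epsilon> \<le> Y k \<omega>} \<le> expectation (Y m) + (\<Sum>k<n. e (m + k))"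
proof -
  define S where "S n = {\<omega> \<in> space M. \<forall>k\<in>{m..m + n}. Y k \<omega> < \<epsilon>}" for n
  have mono': "sets (F k) \<subseteq> sets (F n)" if "k \<le> n" for k n
    using lift_Suc_mono_le[of "\<lambda>n. sets (F n)", OF mono that] .
  have space: "space (F n) = space M" for n
    using sub[of n] by (simp add: subalgebra_def)
  have S_F: "S n \<in> sets (F (m + n))" for n
  proof -
    have "{\<omega> \<in> space M. Y k \<omega> < \<epsilon>} \<in> sets (F (m + n))" if "k \<in> {m..m + n}" for k
    proof -
      have "{\<omega> \<in> space (F k). Y k \<omega> < \<epsilon>} \<in> sets (F k)"
        using Y(1)[of k] by measurable
      then show ?thesis
        using mono'[of k "m + n"] that by (auto simp: space)
    qed
    then have "{\<omega> \<in> space (F (m + n)). \<forall>k\<in>{m..m + n}. Y k \<omega> < \<epsilon>} \<in> sets (F (m + n))"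
      by (intro sets.sets_Collect_finite_All) (simp_all add: space)
    then show ?thesis
      by (simp add: S_def space)
  qed
  have S_M: "S n \<in> events" for n
    using S_F[of n] sub[of "m + n"] by (auto simp: subalgebra_def)
  have int: "integrable M (\<lambda>\<omega>. indicator (S n) \<omega> * Y k \<omega>)" for n k
    using integrable_real_mult_indicator[OF S_M[of n] Y(2)[of k]] by (simp add: mult.commute)
  have ind: "integrable M (\<lambda>\<omega>. \<epsilon> * (1 - indicator (S n) \<omega>))" for n
    by (intro integrable_bounded_rv bounded_rv_intros S_M)
  have E_ind: "(\<integral>\<omega>. \<epsilon> * (1 - indicator (S n) \<omega>) \<partial>M) = \<epsilon> * (1 - prob (S n))" for n
    using S_M[of n] integrable_bounded_rv[OF bounded_rv_indicator[OF S_M[of n]]]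
    by (simp add: prob_space)
  \<comment> \<open>The expectation of the process stopped at first passage, with the value at
    passage lowered to \<open>\<epsilon>\<close>; it increases by at most the error in each
    step.\<close>
  define \<phi> where "\<phi> n = (\<integral>\<omega>. indicator (S n) \<omega> * Y (m + n) \<omega> \<partial>M) + \<epsilon> * (1 - prob (S n))" for n
  have int': "integrable M (\<lambda>\<omega>. indicator (S n) \<omega> * Y k \<omega> + \<epsilon> * (1 - indicator (S n) \<omega>))" for n k
    by (intro Bochner_Integration.integrable_add int ind)
  have E_int': "(\<integral>\<omega>. indicator (S n) \<omega> * Y k \<omega> + \<epsilon> * (1 - indicator (S n) \<omega>) \<partial>M) =
      (\<integral>\<omega>. indicator (S n) \<omega> * Y k \<omega> \<partial>M) + \<epsilon> * (1 - prob (S n))" for n k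
    by (simp only: Bochner_Integration.integral_add[OF int ind] E_ind)
  have \<phi>: "\<phi> n = (\<integral>\<omega>. indicator (S n) \<omega> * Y (m + n) \<omega> + \<epsilon> * (1 - indicator (S n) \<omega>) \<partial>M)" for n
    by (simp only: \<phi>_def E_int')
  have \<phi>_Suc: "\<phi> (Suc n) \<le> \<phi> n + e (m + n)" for n
  proof -
    have S_Suc: "\<omega> \<in> S (Suc n) \<longleftrightarrow> \<omega> \<in> S n \<and> Y (Suc (m + n)) \<omega> < \<epsilon>" for \<omega>
      by (auto simp: S_def atLeastAtMostSuc_conv)
    \<comment> \<open>Where passage occurs at this step, the process is at least
      \<open>\<epsilon>\<close>, so replacing it by \<open>\<epsilon>\<close> only decreases the
      integrand.\<close>
    have "\<phi> (Suc n) \<le> (\<integral>\<omega>. indicator (S n) \<omega> * Y (Suc (m + n)) \<omega> + \<epsilon> * (1 - indicator (S n) \<omega>) \<partial>M)"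
      unfolding \<phi>
    proof (rule integral_mono[OF int' int'])
      fix \<omega> assume "\<omega> \<in> space M"
      then show "indicator (S (Suc n)) \<omega> * Y (m + Suc n) \<omega> + \<epsilon> * (1 - indicator (S (Suc n)) \<omega>)
          \<le> indicator (S n) \<omega> * Y (Suc (m + n)) \<omega> + \<epsilon> * (1 - indicator (S n) \<omega>)"
        by (auto simp: S_Suc indicator_def)
    qed
    also have "\<dots> = (\<integral>\<omega>. indicator (S n) \<omega> * Y (Suc (m + n)) \<omega> \<partial>M) + \<epsilon> * (1 - prob (S n))"
      by (rule E_int')
    also have "\<dots> \<le> \<phi> n + e (m + n)"
      using step[OF S_F[of n]] by (simp add: \<phi>_def)
    finally show ?thesis .
  qed
  have "\<phi> 0 \<le> expectation (Y m)"
    unfolding \<phi>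
  proof (rule integral_mono[OF int' Y(2)])
    fix \<omega> assume "\<omega> \<in> space M"
    then show "indicator (S 0) \<omega> * Y (m + 0) \<omega> + \<epsilon> * (1 - indicator (S 0) \<omega>) \<le> Y m \<omega>"
      by (auto simp: S_def indicator_def not_less)
  qed
  then have bound: "\<phi> n \<le> expectation (Y m) + (\<Sum>k<n. e (m + k))" for n
  proof (induction n)
    case (Suc n)
    then show ?case
      using \<phi>_Suc[of n] by simp
  qed simp
  have "{\<omega> \<in> space M. \<exists>k\<in>{m..m + n}. \<epsilon> \<le> Y k \<omega>} = space M - S n"
    by (auto simp: S_def not_less)
  then have "\<epsilon> * prob {\<omega> \<in> space M. \<exists>k\<in>{m..m + n}. \<epsilon> \<le> Y k \<omega>} = \<epsilon> * (1 - prob (S n))"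
    using prob_compl[OF S_M[of n]] by simp
  also have "\<dots> \<le> \<phi> n"
    unfolding \<phi>_def by (simp add: integral_nonneg_AE nonneg indicator_def)
  finally show ?thesis
    using bound[of n] by linarith
qed

text \<open>Exceeding \<open>\<epsilon>\<close> infinitely often implies exceeding it after time
  \<open>m\<close>, and the maximal inequality bounds that probability by the expectation at
  \<open>m\<close> plus the tail of the errors. Both become small at suitable late \<open>m\<close>,
  so it suffices that the expectation is small at infinitely many times.\<close>

lemma (in prob_space) almost_supermartingale_tendsto_0:
  fixes Y :: "nat \<Rightarrow> 'a \<Rightarrow> real"
  assumes sub: "\<And>n. subalgebra M (F n)" and mono: "\<And>n. sets (F n) \<subseteq> sets (F (Suc n))"
    and Y: "\<And>n. Y n \<in> borel_measurable (F n)" "\<And>n. integrable M (Y n)"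
    and nonneg: "\<And>n \<omega>. \<omega> \<in> space M \<Longrightarrow> 0 \<le> Y n \<omega>"
    and step: "\<And>n S. S \<in> sets (F n) \<Longrightarrow>
      (\<integral>\<omega>. indicator S \<omega> * Y (Suc n) \<omega> \<partial>M) \<le> (\<integral>\<omega>. indicator S \<omega> * Y n \<omega> \<partial>M) + e n"
    and e: "summable e" "\<And>n. 0 \<le> e n"
    and small: "\<And>\<delta> k. 0 < \<delta> \<Longrightarrow> \<exists>m\<ge>k. expectation (Y m) < \<delta>"
  shows "AE \<omega> in M. (\<lambda>n. Y n \<omega>) \<longlonglongrightarrow> 0"
proof -
  have [measurable]: "Y n \<in> borel_measurable M" for n
    using measurable_from_subalg[OF sub Y(1)] .
  have "AE \<omega> in M. \<exists>m. \<forall>n\<ge>m. Y n \<omega> < \<epsilon>" if eps: "0 < \<epsilon>" for \<epsilon>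
  proof -
    define B where "B = {\<omega> \<in> space M. \<forall>m. \<exists>n\<ge>m. \<epsilon> \<le> Y n \<omega>}"
    have B: "B \<in> events"
      unfolding B_def by measurable
    have le: "\<epsilon> * prob B \<le> expectation (Y m) + (\<Sum>k. e (k + m))" for m
    \<comment> \<open>The event of passage in a finite window grows with the window, so the bound of
      the maximal inequality carries over to the union.\<close>
    proof -
      define U where "U n = {\<omega> \<in> space M. \<exists>k\<in>{m..m + n}. \<epsilon> \<le> Y k \<omega>}" for n
      have U: "U n \<in> events" for n
        unfolding U_def by measurable
      have "incseq U"
        by (intro incseq_SucI) (auto simp: U_def)
      then have lim: "(\<lambda>n. prob (U n)) \<longlonglongrightarrow> prob (\<Union>n. U n)"
        using U by (intro finite_Lim_measure_incseq) auto
      have "\<epsilon> * prob (U n) \<le> expectation (Y m) + (\<Sum>k. e (k + m))" for n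
      proof -
        have "\<epsilon> * prob (U n) \<le> expectation (Y m) + (\<Sum>k<n. e (m + k))"
          unfolding U_def using maximal_inequality[where F = F, OF sub mono Y nonneg step eps] .
        also have "(\<Sum>k<n. e (m + k)) \<le> (\<Sum>k. e (k + m))"
          using sum_le_suminf[of "\<lambda>k. e (k + m)" "{..<n}"] e summable_ignore_initial_segment[OF e(1)]
          by (simp add: add.commute)
        finally show ?thesis by simp
      qed
      then have "\<epsilon> * prob (\<Union>n. U n) \<le> expectation (Y m) + (\<Sum>k. e (k + m))"
        using LIMSEQ_le_const2[OF tendsto_mult_left[OF lim, of \<epsilon>]] by blast
      moreover have "B \<subseteq> (\<Union>n. U n)"
      proof
        fix \<omega> assume "\<omega> \<in> B"
        then obtain n where "\<omega> \<in> space M" "m \<le> n" "\<epsilon> \<le> Y n \<omega>"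
          by (auto simp: B_def)
        then have "\<omega> \<in> U (n - m)"
          by (auto simp: U_def)
        then show "\<omega> \<in> (\<Union>n. U n)" by blast
      qed
      then have "prob B \<le> prob (\<Union>n. U n)"
        using U by (intro finite_measure_mono) auto
      ultimately show ?thesis
        using eps by (meson less_imp_le mult_left_mono order_trans)
    qed
    have "\<epsilon> * prob B \<le> 0"
    proof (rule field_le_epsilon)
      fix \<delta> :: real assume "0 < \<delta>"
      then have "\<forall>\<^sub>F m in sequentially. (\<Sum>k. e (k + m)) < \<delta> / 2"
        by (intro order_tendstoD(2)[OF suminf_exist_split2[OF e(1)]]) simp
      then obtain k where "\<And>m. k \<le> m \<Longrightarrow> (\<Sum>k. e (k + m)) < \<delta> / 2"
        unfolding eventually_sequentially by blast
      moreover obtain m where "k \<le> m" "expectation (Y m) < \<delta> / 2"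
        using small[of "\<delta> / 2" k] \<open>0 < \<delta>\<close> by auto
      ultimately show "\<epsilon> * prob B \<le> 0 + \<delta>"
        using le[of m] by fastforce
    qed
    then have "prob B = 0"
      using eps measure_nonneg[of M B] by (simp add: mult_le_0_iff)
    then have "AE \<omega> in M. \<omega> \<notin> B"
      using B by (simp add: prob_eq_0)
    then show ?thesis
      by (rule AE_mp) (rule AE_I2, simp add: B_def, meson not_le)
  qed
  \<comment> \<open>Countably many thresholds keep the exceptional set null and still suffice for
    convergence.\<close>
  then have "AE \<omega> in M. \<forall>j. \<exists>m. \<forall>n\<ge>m. Y n \<omega> < 1 / Suc j"
    by (subst AE_all_countable) simp
  then show ?thesis
  proof (rule AE_mp, intro AE_I2 impI)
    fix \<omega> assume \<omega>: "\<omega> \<in> space M" and ev: "\<forall>j. \<exists>m. \<forall>n\<ge>m. Y n \<omega> < 1 / Suc j"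
    show "(\<lambda>n. Y n \<omega>) \<longlonglongrightarrow> 0"
    proof (rule LIMSEQ_I)
      fix \<epsilon> :: real assume "0 < \<epsilon>"
      then obtain j where "1 / Suc j < \<epsilon>"
        using nat_approx_posE by blast
      moreover obtain m where "\<forall>n\<ge>m. Y n \<omega> < 1 / Suc j"
        using ev by blast
      ultimately show "\<exists>m. \<forall>n\<ge>m. norm (Y n \<omega> - 0) < \<epsilon>"
        using nonneg[OF \<omega>] by (intro exI[of _ m]) fastforce
    qed
  qed
qed

subsection \<open>The reinforced network\<close>

locale reinforced_network = stochastic_cycle A v c + prob_space M
  for A :: "real ^ 'n ^ 'n" and v c and M :: "'a measure" +
  fixes r :: "nat \<Rightarrow> real" and X Z :: "nat \<Rightarrow> 'a \<Rightarrow> real ^ 'n"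
  assumes r_range: "0 < r n" "r n < 1"
    and Z0_measurable: "Z 0 \<in> borel_measurable M"
    and Z0_range: "\<omega> \<in> space M \<Longrightarrow> 0 \<le> Z 0 \<omega> $ l \<and> Z 0 \<omega> $ l \<le> 1"
    and Z0_nontrivial:
      "measure M {\<omega> \<in> space M. Z 0 \<omega> = 0} + measure M {\<omega> \<in> space M. Z 0 \<omega> = 1} < 1"
    and X_measurable: "X (Suc n) \<in> borel_measurable M"
    and X_range: "\<omega> \<in> space M \<Longrightarrow> X (Suc n) \<omega> $ l \<in> {0, 1}"
    and X_cond_indep: "cond_indep_vars M (history M (Z 0) X n) (\<lambda>l \<omega>. X (Suc n) \<omega> $ l)"
    and X_cond_prob:
      "AE \<omega> in M. cprob M (history M (Z 0) X n) {\<eta> \<in> space M. X (Suc n) \<eta> $ l = 1} \<omega>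
                  = (A *v Z n \<omega>) $ l"
    and Z_step: "\<omega> \<in> space M \<Longrightarrow> Z (Suc n) \<omega> = (1 - r n) *\<^sub>R Z n \<omega> + r n *\<^sub>R X (Suc n) \<omega>"
begin

section \<open>Filtration, adaptedness and ranges of the processes\<close>

definition F :: "nat \<Rightarrow> 'a measure" where
  "F n = history M (Z 0) X n"

definition p :: "nat \<Rightarrow> 'n \<Rightarrow> 'a \<Rightarrow> real" where
  "p n l \<omega> = (A *v Z n \<omega>) $ l"

lemma X_nth_measurable: "(\<lambda>\<omega>. X (Suc n) \<omega> $ l) \<in> borel_measurable M"
  using measurable_compose[OF X_measurable borel_measurable_vec_nth] .

lemma Z0_nth_measurable: "(\<lambda>\<omega>. Z 0 \<omega> $ l) \<in> borel_measurable M"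
  using measurable_compose[OF Z0_measurable borel_measurable_vec_nth] .

lemma space_F: "space (F n) = space M"
  by (auto simp: F_def history_def space_measure_of_conv)

lemma sets_F: "sets (F n) = sigma_sets (space M)
     ({(\<lambda>\<omega>. Z 0 \<omega> $ l) -` B \<inter> space M | l B. B \<in> sets borel} \<union>
      {(\<lambda>\<omega>. X k \<omega> $ l) -` B \<inter> space M | k l B. 1 \<le> k \<and> k \<le> n \<and> B \<in> sets borel})"
  unfolding F_def history_def by (rule sets_measure_of) auto

lemma subalgebra_F: "subalgebra M (F n)"
  unfolding subalgebra_def space_F sets_F
proof (intro conjI refl sets.sigma_sets_subset subsetI, elim UnE CollectE exE conjE)
  fix S l and B :: "real set"
  assume "S = (\<lambda>\<omega>. Z 0 \<omega> $ l) -` B \<inter> space M" "B \<in> sets borel"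
  then show "S \<in> sets M"
    using measurable_sets[OF Z0_nth_measurable] by simp
next
  fix S k l and B :: "real set"
  assume "S = (\<lambda>\<omega>. X k \<omega> $ l) -` B \<inter> space M" "B \<in> sets borel" "1 \<le> k"
  then show "S \<in> sets M"
    using measurable_sets[OF X_nth_measurable[of "k - 1"]] by simp
qed

lemma sets_F_mono: "sets (F n) \<subseteq> sets (F (Suc n))"
  unfolding sets_F
proof (intro sigma_sets_mono' Un_mono order_refl subsetI, elim CollectE exE conjE)
  fix S k l and B :: "real set"
  assume "S = (\<lambda>\<omega>. X k \<omega> $ l) -` B \<inter> space M" "1 \<le> k" "k \<le> n" "B \<in> sets borel"
  then show "S \<in> {(\<lambda>\<omega>. X k \<omega> $ l) -` B \<inter> space M | k l B. 1 \<le> k \<and> k \<le> Suc n \<and> B \<in> sets borel}"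
    by (intro CollectI exI[of _ k] exI[of _ l] exI[of _ B]) simp
qed

lemma Z_bounded_rv_F: "(\<lambda>\<omega>. Z n \<omega> $ l) \<in> bounded_rv (F n)"
proof (induction n arbitrary: l)
  case 0
  show ?case
  proof (rule bounded_rvI)
    show "(\<lambda>\<omega>. Z 0 \<omega> $ l) \<in> borel_measurable (F 0)"
      by (rule measurableI) (auto simp: space_F sets_F intro!: sigma_sets.Basic)
    show "\<bar>Z 0 \<omega> $ l\<bar> \<le> 1" if "\<omega> \<in> space (F 0)" for \<omega>
      using Z0_range[of \<omega> l] that by (simp add: space_F)
  qed
next
  case (Suc n)
  have "(\<lambda>\<omega>. Z n \<omega> $ l) \<in> bounded_rv (F (Suc n))"
    by (rule bounded_rv_subalgebra[OF _ Suc]) (simp add: subalgebra_def space_F sets_F_mono)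
  moreover have "(\<lambda>\<omega>. X (Suc n) \<omega> $ l) \<in> bounded_rv (F (Suc n))"
  proof (rule bounded_rvI)
    show "(\<lambda>\<omega>. X (Suc n) \<omega> $ l) \<in> borel_measurable (F (Suc n))"
    proof (rule measurableI)
      fix B :: "real set" assume "B \<in> sets borel"
      then have "(\<lambda>\<omega>. X (Suc n) \<omega> $ l) -` B \<inter> space M \<in>
          {(\<lambda>\<omega>. X k \<omega> $ l) -` B \<inter> space M | k l B. 1 \<le> k \<and> k \<le> Suc n \<and> B \<in> sets borel}"
        unfolding mem_Collect_eq by (intro exI[of _ "Suc n"] exI[of _ l] exI[of _ B]) simp
      then show "(\<lambda>\<omega>. X (Suc n) \<omega> $ l) -` B \<inter> space (F (Suc n)) \<in> sets (F (Suc n))"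
        unfolding space_F sets_F by (intro sigma_sets.Basic UnI2)
    qed simp
    show "\<bar>X (Suc n) \<omega> $ l\<bar> \<le> 1" if "\<omega> \<in> space (F (Suc n))" for \<omega>
      using X_range[of \<omega> n l] that by (auto simp: space_F)
  qed
  ultimately have "(\<lambda>\<omega>. (1 - r n) * Z n \<omega> $ l + r n * X (Suc n) \<omega> $ l) \<in> bounded_rv (F (Suc n))"
    by (intro bounded_rv_intros)
  then show ?case
    by (subst bounded_rv_cong) (auto simp: space_F Z_step)
qed

lemma p_bounded_rv_F: "p n l \<in> bounded_rv (F n)"
  unfolding p_def[abs_def] matrix_vector_mult_def vec_lambda_beta
  by (intro bounded_rv_intros Z_bounded_rv_F)

lemmas bounded_rv_F_M = bounded_rv_subalgebra[OF subalgebra_F]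

lemma X_bounded_rv: "(\<lambda>\<omega>. X (Suc n) \<omega> $ l) \<in> bounded_rv M"
proof (rule bounded_rvI[OF X_nth_measurable])
  show "\<bar>X (Suc n) \<omega> $ l\<bar> \<le> 1" if "\<omega> \<in> space M" for \<omega>
    using X_range[OF that, of n l] by auto
qed

lemmas rv_intros = bounded_rv_intros X_bounded_rv bounded_rv_F_M[OF p_bounded_rv_F]
  bounded_rv_F_M[OF Z_bounded_rv_F]

lemma Z_range: "\<omega> \<in> space M \<Longrightarrow> 0 \<le> Z n \<omega> $ l \<and> Z n \<omega> $ l \<le> 1"
proof (induction n)
  case 0
  then show ?case by (rule Z0_range)
next
  case (Suc n)
  have Z: "0 \<le> Z n \<omega> $ l" "Z n \<omega> $ l \<le> 1" and X: "0 \<le> X (Suc n) \<omega> $ l" "X (Suc n) \<omega> $ l \<le> 1"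
    using Suc X_range[of \<omega> n l] by auto
  have "(1 - r n) * Z n \<omega> $ l + r n * X (Suc n) \<omega> $ l \<le> 1"
    using Z X r_range[of n] by (intro convex_bound_le) auto
  then show ?case
    using Z X r_range[of n] Suc.prems by (simp add: Z_step)
qed

lemma p_range:
  assumes "\<omega> \<in> space M"
  shows "0 \<le> p n l \<omega> \<and> p n l \<omega> \<le> 1"
proof
  show "0 \<le> p n l \<omega>"
    using Z_range[OF assms] A_entry_nonneg by (simp add: p_def matrix_vector_mult_def sum_nonneg)
  have "p n l \<omega> \<le> (\<Sum>j\<in>UNIV. A $ l $ j * 1)"
    unfolding p_def matrix_vector_mult_def
    using Z_range[OF assms] A_entry_nonneg by (simp, intro sum_mono mult_left_le) auto
  then show "p n l \<omega> \<le> 1"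
    by (simp add: row_sum)
qed

text \<open>The defining property of conditional expectation. From here on the conditional laws
  enter only integrated against bounded \<open>F n\<close>-measurable test functions
  \<open>g\<close>.\<close>

lemma expectation_mult_indicator:
  assumes g: "g \<in> bounded_rv (F n)" and S: "S \<in> events" and q: "q \<in> bounded_rv M"
    and cond: "AE \<omega> in M. cprob M (F n) S \<omega> = q \<omega>"
  shows "(\<integral>\<omega>. g \<omega> * indicator S \<omega> \<partial>M) = (\<integral>\<omega>. g \<omega> * q \<omega> \<partial>M)"
proof -
  interpret finite_measure_subalgebra M "F n"
    by unfold_locales (rule subalgebra_F)
  have "(\<integral>\<omega>. g \<omega> * indicator S \<omega> \<partial>M) = (\<integral>\<omega>. g \<omega> * real_cond_exp M (F n) (indicator S) \<omega> \<partial>M)"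
    using g S bounded_rv_measurable[OF g]
    by (intro real_cond_exp_intg(2)[symmetric] integrable_bounded_rv bounded_rv_intros bounded_rv_F_M) auto
  also have "\<dots> = (\<integral>\<omega>. g \<omega> * q \<omega> \<partial>M)"
  proof (rule integral_cong_AE)
    show "(\<lambda>\<omega>. g \<omega> * real_cond_exp M (F n) (indicator S) \<omega>) \<in> borel_measurable M"
      using bounded_rv_measurable[OF bounded_rv_F_M[OF g]] by measurable
    show "(\<lambda>\<omega>. g \<omega> * q \<omega>) \<in> borel_measurable M"
      by (intro bounded_rv_measurable bounded_rv_intros bounded_rv_F_M[OF g] q)
    show "AE \<omega> in M. g \<omega> * real_cond_exp M (F n) (indicator S) \<omega> = g \<omega> * q \<omega>"
      using cond by (auto simp: cprob_def)
  qed
  finally show ?thesis .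
qed

section \<open>First and second conditional moments of the actions\<close>

lemma X_event: "{\<eta> \<in> space M. X (Suc n) \<eta> $ l \<in> B} \<in> events" if "B \<in> sets borel"
  using measurable_sets[OF X_nth_measurable that, of n l] by (simp add: vimage_def Int_def conj_commute)

lemma expectation_mult_X:
  assumes "g \<in> bounded_rv (F n)"
  shows "(\<integral>\<omega>. g \<omega> * X (Suc n) \<omega> $ l \<partial>M) = (\<integral>\<omega>. g \<omega> * p n l \<omega> \<partial>M)"
proof -
  let ?S = "{\<eta> \<in> space M. X (Suc n) \<eta> $ l = 1}"
  have "(\<integral>\<omega>. g \<omega> * X (Suc n) \<omega> $ l \<partial>M) = (\<integral>\<omega>. g \<omega> * indicator ?S \<omega> \<partial>M)"
    using X_range[of _ n l] by (intro Bochner_Integration.integral_cong) (auto simp: indicator_def)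
  also have "\<dots> = (\<integral>\<omega>. g \<omega> * p n l \<omega> \<partial>M)"
  proof (rule expectation_mult_indicator[OF assms])
    show "?S \<in> events"
      using X_event[of "{1}" n l] by simp
    show "AE \<omega> in M. cprob M (F n) ?S \<omega> = p n l \<omega>"
      unfolding F_def p_def by (rule X_cond_prob)
  qed (rule rv_intros)
  finally show ?thesis .
qed

text \<open>Supplies the trivial factors when conditional independence is specialised to two
  indices.\<close>

lemma cprob_space: "AE \<omega> in M. cprob M (F n) (space M) \<omega> = 1"
proof -
  interpret finite_measure_subalgebra M "F n"
    by unfold_locales (rule subalgebra_F)
  have ind: "indicator (space M) \<in> bounded_rv (F n)"
    by (intro bounded_rv_indicator) (metis sets.top space_F)
  have "AE \<omega> in M. real_cond_exp M (F n) (indicator (space M)) \<omega> = indicator (space M) \<omega>"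
    by (intro real_cond_exp_F_meas integrable_bounded_rv bounded_rv_F_M[OF ind] bounded_rv_measurable[OF ind])
  then show ?thesis
    by (rule AE_mp) (auto simp: cprob_def)
qed

lemma cprob_X_X:
  assumes "l \<noteq> k"
  shows "AE \<omega> in M. cprob M (F n) {\<eta> \<in> space M. X (Suc n) \<eta> $ l = 1 \<and> X (Suc n) \<eta> $ k = 1} \<omega>
    = p n l \<omega> * p n k \<omega>"
proof -
  \<comment> \<open>Choosing the whole line for all other indices reduces the product over the full
    family to the two factors at \<open>l\<close> and \<open>k\<close>.\<close>
  define B where "B j = (if j = l \<or> j = k then {1} else UNIV :: real set)" for j
  let ?c = "\<lambda>j. cprob M (F n) {\<eta> \<in> space M. X (Suc n) \<eta> $ j \<in> B j}"
  have event: "{\<eta> \<in> space M. \<forall>j. X (Suc n) \<eta> $ j \<in> B j} =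
      {\<eta> \<in> space M. X (Suc n) \<eta> $ l = 1 \<and> X (Suc n) \<eta> $ k = 1}"
    by (auto simp: B_def)
  have "AE \<omega> in M. cprob M (F n) {\<eta> \<in> space M. \<forall>j. X (Suc n) \<eta> $ j \<in> B j} \<omega> = (\<Prod>j\<in>UNIV. ?c j \<omega>)"
    using X_cond_indep[of n] unfolding cond_indep_vars_def F_def by (auto simp: B_def)
  moreover have "AE \<omega> in M. ?c j \<omega> = (if j = l \<or> j = k then p n j \<omega> else 1)" for j
  proof (cases "j = l \<or> j = k")
    case True
    then show ?thesis
      using X_cond_prob[of n j] by (simp add: B_def p_def F_def)
  next
    case False
    then show ?thesis
      using cprob_space[of n] by (simp add: B_def)
  qed
  then have "AE \<omega> in M. \<forall>j\<in>UNIV. ?c j \<omega> = (if j = l \<or> j = k then p n j \<omega> else 1)"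
    by (intro AE_finite_allI) auto
  ultimately show ?thesis
  proof eventually_elim
    case (elim \<omega>)
    have "(\<Prod>j\<in>UNIV. ?c j \<omega>) = (\<Prod>j\<in>UNIV. if j = l \<or> j = k then p n j \<omega> else 1)"
      using elim by (intro prod.cong) auto
    also have "\<dots> = (\<Prod>j\<in>{l, k}. p n j \<omega>)"
      by (intro prod.mono_neutral_cong_right) auto
    finally show ?case
      using elim assms by (simp add: event)
  qed
qed

lemma expectation_mult_X_X:
  assumes "g \<in> bounded_rv (F n)" "l \<noteq> k"
  shows "(\<integral>\<omega>. g \<omega> * (X (Suc n) \<omega> $ l * X (Suc n) \<omega> $ k) \<partial>M) = (\<integral>\<omega>. g \<omega> * (p n l \<omega> * p n k \<omega>) \<partial>M)"
proof -
  let ?S = "{\<eta> \<in> space M. X (Suc n) \<eta> $ l = 1 \<and> X (Suc n) \<eta> $ k = 1}"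
  have "(\<integral>\<omega>. g \<omega> * (X (Suc n) \<omega> $ l * X (Suc n) \<omega> $ k) \<partial>M) = (\<integral>\<omega>. g \<omega> * indicator ?S \<omega> \<partial>M)"
  proof (rule Bochner_Integration.integral_cong[OF refl])
    fix \<omega> assume "\<omega> \<in> space M"
    then show "g \<omega> * (X (Suc n) \<omega> $ l * X (Suc n) \<omega> $ k) = g \<omega> * indicator ?S \<omega>"
      using X_range[of \<omega> n l] X_range[of \<omega> n k] by (auto simp: indicator_def)
  qed
  also have "\<dots> = (\<integral>\<omega>. g \<omega> * (p n l \<omega> * p n k \<omega>) \<partial>M)"
  proof (rule expectation_mult_indicator[OF assms(1) _ _ cprob_X_X[OF assms(2)]])
    have "?S = {\<eta> \<in> space M. X (Suc n) \<eta> $ l \<in> {1}} \<inter> {\<eta> \<in> space M. X (Suc n) \<eta> $ k \<in> {1}}"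
      by auto
    also have "\<dots> \<in> events"
      by (intro sets.Int X_event) simp_all
    finally show "?S \<in> events" .
  qed (intro rv_intros)
  finally show ?thesis .
qed

text \<open>The innovations: what the actions add to their conditional means.\<close>

abbreviation \<Delta> :: "nat \<Rightarrow> 'n \<Rightarrow> 'a \<Rightarrow> real" where
  "\<Delta> n l \<omega> \<equiv> X (Suc n) \<omega> $ l - p n l \<omega>"

lemma expectation_mult_\<Delta>:
  assumes g: "g \<in> bounded_rv (F n)"
  shows "(\<integral>\<omega>. g \<omega> * \<Delta> n l \<omega> \<partial>M) = 0"
proof -
  have "(\<integral>\<omega>. g \<omega> * \<Delta> n l \<omega> \<partial>M) =
      (\<integral>\<omega>. g \<omega> * X (Suc n) \<omega> $ l \<partial>M) - (\<integral>\<omega>. g \<omega> * p n l \<omega> \<partial>M)"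
    unfolding right_diff_distrib
    by (intro Bochner_Integration.integral_diff integrable_bounded_rv rv_intros bounded_rv_F_M[OF g])
  then show ?thesis
    by (simp add: expectation_mult_X[OF g])
qed

text \<open>After expansion, each term with a single innovation carries an
  \<open>F n\<close>-measurable factor and vanishes. The rest is zero by conditional independence
  for \<open>l \<noteq> k\<close>, and is the Bernoulli variance for \<open>l = k\<close>, since the
  actions equal their squares.\<close>

lemma expectation_mult_\<Delta>_\<Delta>:
  assumes g: "g \<in> bounded_rv (F n)"
  shows "(\<integral>\<omega>. g \<omega> * (\<Delta> n l \<omega> * \<Delta> n k \<omega>) \<partial>M) =
    (if l = k then \<integral>\<omega>. g \<omega> * (p n l \<omega> * (1 - p n l \<omega>)) \<partial>M else 0)"
proof -
  note gM = bounded_rv_F_M[OF g]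
  have gp: "(\<lambda>\<omega>. g \<omega> * p n j \<omega>) \<in> bounded_rv (F n)" for j
    by (intro bounded_rv_intros g p_bounded_rv_F)
  have "(\<integral>\<omega>. g \<omega> * (\<Delta> n l \<omega> * \<Delta> n k \<omega>) \<partial>M) =
      (\<integral>\<omega>. g \<omega> * (X (Suc n) \<omega> $ l * X (Suc n) \<omega> $ k) - g \<omega> * (p n l \<omega> * p n k \<omega>)
        - (g \<omega> * p n l \<omega> * \<Delta> n k \<omega> + g \<omega> * p n k \<omega> * \<Delta> n l \<omega>) \<partial>M)"
    by (intro Bochner_Integration.integral_cong) (auto simp: algebra_simps)
  also have "\<dots> = (\<integral>\<omega>. g \<omega> * (X (Suc n) \<omega> $ l * X (Suc n) \<omega> $ k) - g \<omega> * (p n l \<omega> * p n k \<omega>) \<partial>M)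
      - ((\<integral>\<omega>. g \<omega> * p n l \<omega> * \<Delta> n k \<omega> \<partial>M) + (\<integral>\<omega>. g \<omega> * p n k \<omega> * \<Delta> n l \<omega> \<partial>M))"
    by (subst Bochner_Integration.integral_diff Bochner_Integration.integral_add,
        (intro integrable_bounded_rv rv_intros gM)+)+ simp
  also have "\<dots> = (\<integral>\<omega>. g \<omega> * (X (Suc n) \<omega> $ l * X (Suc n) \<omega> $ k) - g \<omega> * (p n l \<omega> * p n k \<omega>) \<partial>M)"
    by (simp only: expectation_mult_\<Delta>[OF gp])
  also have "\<dots> = (if l = k then \<integral>\<omega>. g \<omega> * (p n l \<omega> * (1 - p n l \<omega>)) \<partial>M else 0)"
  proof (cases "l = k")
    case True
    have "(\<integral>\<omega>. g \<omega> * (X (Suc n) \<omega> $ l * X (Suc n) \<omega> $ k) - g \<omega> * (p n l \<omega> * p n k \<omega>) \<partial>M)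
        = (\<integral>\<omega>. g \<omega> * \<Delta> n l \<omega> + g \<omega> * (p n l \<omega> * (1 - p n l \<omega>)) \<partial>M)"
    proof (rule Bochner_Integration.integral_cong[OF refl])
      fix \<omega> assume "\<omega> \<in> space M"
      then have "X (Suc n) \<omega> $ l * X (Suc n) \<omega> $ l = X (Suc n) \<omega> $ l"
        using X_range[of \<omega> n l] by auto
      then show "g \<omega> * (X (Suc n) \<omega> $ l * X (Suc n) \<omega> $ k) - g \<omega> * (p n l \<omega> * p n k \<omega>) =
          g \<omega> * \<Delta> n l \<omega> + g \<omega> * (p n l \<omega> * (1 - p n l \<omega>))"
        using True by (simp add: algebra_simps)
    qed
    also have "\<dots> = (\<integral>\<omega>. g \<omega> * \<Delta> n l \<omega> \<partial>M) + (\<integral>\<omega>. g \<omega> * (p n l \<omega> * (1 - p n l \<omega>)) \<partial>M)"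
      by (intro Bochner_Integration.integral_add integrable_bounded_rv rv_intros gM)
    finally show ?thesis
      using True by (simp add: expectation_mult_\<Delta>[OF g])
  next
    case False
    have "(\<integral>\<omega>. g \<omega> * (X (Suc n) \<omega> $ l * X (Suc n) \<omega> $ k) - g \<omega> * (p n l \<omega> * p n k \<omega>) \<partial>M)
        = (\<integral>\<omega>. g \<omega> * (X (Suc n) \<omega> $ l * X (Suc n) \<omega> $ k) \<partial>M) - (\<integral>\<omega>. g \<omega> * (p n l \<omega> * p n k \<omega>) \<partial>M)"
      by (intro Bochner_Integration.integral_diff integrable_bounded_rv rv_intros gM)
    then show ?thesis
      using False by (simp add: expectation_mult_X_X[OF g False])
  qed
  finally show ?thesis .
qed

text \<open>A Pythagorean decomposition into predictable part and innovations: the cross terms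
  vanish and the innovations are uncorrelated. The weights \<open>u\<close> are left free because
  both \<open>v\<close> and \<open>\<gamma> h\<close> are inserted; the test function
  \<open>g\<close> will be 1 or the indicator of an event.\<close>

lemma second_moment_step:
  assumes g: "g \<in> bounded_rv (F n)"
  shows "(\<integral>\<omega>. g \<omega> * (\<Sum>l\<in>UNIV. u l * Z (Suc n) \<omega> $ l)\<^sup>2 \<partial>M) =
    (\<integral>\<omega>. g \<omega> * (\<Sum>l\<in>UNIV. u l * ((1 - r n) * Z n \<omega> $ l + r n * p n l \<omega>))\<^sup>2 \<partial>M) +
    (r n)\<^sup>2 * (\<Sum>l\<in>UNIV. (u l)\<^sup>2 * (\<integral>\<omega>. g \<omega> * (p n l \<omega> * (1 - p n l \<omega>)) \<partial>M))"
proof -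
  note gM = bounded_rv_F_M[OF g]
  \<comment> \<open>The conditional mean of the weighted sum at the next step.\<close>
  define m where "m \<omega> = (\<Sum>l\<in>UNIV. u l * ((1 - r n) * Z n \<omega> $ l + r n * p n l \<omega>))" for \<omega>
  have m_rv: "m \<in> bounded_rv (F n)"
    unfolding m_def[abs_def] by (intro bounded_rv_intros Z_bounded_rv_F p_bounded_rv_F)
  note mM = bounded_rv_F_M[OF m_rv]
  have decomp: "g \<omega> * (\<Sum>l\<in>UNIV. u l * Z (Suc n) \<omega> $ l)\<^sup>2 = g \<omega> * (m \<omega>)\<^sup>2
      + (\<Sum>l\<in>UNIV. (2 * r n * u l) * (g \<omega> * m \<omega> * \<Delta> n l \<omega>))
      + (\<Sum>l\<in>UNIV. \<Sum>k\<in>UNIV. ((r n)\<^sup>2 * u l * u k) * (g \<omega> * (\<Delta> n l \<omega> * \<Delta> n k \<omega>)))"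
    if "\<omega> \<in> space M" for \<omega>
  proof -
    define D where "D = (\<Sum>l\<in>UNIV. u l * \<Delta> n l \<omega>)"
    have "(\<Sum>l\<in>UNIV. u l * Z (Suc n) \<omega> $ l) = m \<omega> + r n * D"
      unfolding m_def D_def sum_distrib_left sum.distrib[symmetric]
      by (intro sum.cong) (auto simp: Z_step[OF that] algebra_simps)
    then have "g \<omega> * (\<Sum>l\<in>UNIV. u l * Z (Suc n) \<omega> $ l)\<^sup>2 =
        g \<omega> * (m \<omega>)\<^sup>2 + (2 * r n * g \<omega> * m \<omega>) * D + ((r n)\<^sup>2 * g \<omega>) * (D * D)"
      by (simp add: power2_eq_square algebra_simps)
    moreover have "(2 * r n * g \<omega> * m \<omega>) * D = (\<Sum>l\<in>UNIV. (2 * r n * u l) * (g \<omega> * m \<omega> * \<Delta> n l \<omega>))"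
      unfolding D_def sum_distrib_left by (intro sum.cong) (auto simp: mult_ac)
    moreover have "((r n)\<^sup>2 * g \<omega>) * (D * D) =
        (\<Sum>l\<in>UNIV. \<Sum>k\<in>UNIV. ((r n)\<^sup>2 * u l * u k) * (g \<omega> * (\<Delta> n l \<omega> * \<Delta> n k \<omega>)))"
      unfolding D_def sum_product by (simp add: sum_distrib_left mult_ac)
    ultimately show ?thesis by simp
  qed
  have "(\<integral>\<omega>. g \<omega> * (\<Sum>l\<in>UNIV. u l * Z (Suc n) \<omega> $ l)\<^sup>2 \<partial>M) = (\<integral>\<omega>. g \<omega> * (m \<omega>)\<^sup>2
      + (\<Sum>l\<in>UNIV. (2 * r n * u l) * (g \<omega> * m \<omega> * \<Delta> n l \<omega>))
      + (\<Sum>l\<in>UNIV. \<Sum>k\<in>UNIV. ((r n)\<^sup>2 * u l * u k) * (g \<omega> * (\<Delta> n l \<omega> * \<Delta> n k \<omega>))) \<partial>M)"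
    by (intro Bochner_Integration.integral_cong refl decomp)
  also have "\<dots> = (\<integral>\<omega>. g \<omega> * (m \<omega>)\<^sup>2 \<partial>M)
      + (\<integral>\<omega>. (\<Sum>l\<in>UNIV. (2 * r n * u l) * (g \<omega> * m \<omega> * \<Delta> n l \<omega>)) \<partial>M)
      + (\<integral>\<omega>. (\<Sum>l\<in>UNIV. \<Sum>k\<in>UNIV. ((r n)\<^sup>2 * u l * u k) * (g \<omega> * (\<Delta> n l \<omega> * \<Delta> n k \<omega>))) \<partial>M)"
    by (intro integral_add3 rv_intros gM mM)
  also have "(\<integral>\<omega>. (\<Sum>l\<in>UNIV. (2 * r n * u l) * (g \<omega> * m \<omega> * \<Delta> n l \<omega>)) \<partial>M) = 0"
  proof -
    have "(\<integral>\<omega>. (\<Sum>l\<in>UNIV. (2 * r n * u l) * (g \<omega> * m \<omega> * \<Delta> n l \<omega>)) \<partial>M) =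
        (\<Sum>l\<in>UNIV. (\<integral>\<omega>. (2 * r n * u l) * (g \<omega> * m \<omega> * \<Delta> n l \<omega>) \<partial>M))"
      by (intro Bochner_Integration.integral_sum integrable_bounded_rv rv_intros gM mM)
    also have "\<dots> = 0"
      by (simp only: integral_mult_right_zero expectation_mult_\<Delta>[OF bounded_rv_mult[OF g m_rv]]) simp
    finally show ?thesis .
  qed
  also have "(\<integral>\<omega>. (\<Sum>l\<in>UNIV. \<Sum>k\<in>UNIV. ((r n)\<^sup>2 * u l * u k) * (g \<omega> * (\<Delta> n l \<omega> * \<Delta> n k \<omega>))) \<partial>M) =
      (\<Sum>l\<in>UNIV. (\<integral>\<omega>. (\<Sum>k\<in>UNIV. ((r n)\<^sup>2 * u l * u k) * (g \<omega> * (\<Delta> n l \<omega> * \<Delta> n k \<omega>))) \<partial>M))"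
    by (intro Bochner_Integration.integral_sum integrable_bounded_rv rv_intros gM)
  also have "\<dots> = (\<Sum>l\<in>UNIV. \<Sum>k\<in>UNIV. (\<integral>\<omega>. ((r n)\<^sup>2 * u l * u k) * (g \<omega> * (\<Delta> n l \<omega> * \<Delta> n k \<omega>)) \<partial>M))"
    by (intro sum.cong refl Bochner_Integration.integral_sum integrable_bounded_rv rv_intros gM)
  also have "\<dots> = (\<Sum>l\<in>UNIV. \<Sum>k\<in>UNIV. ((r n)\<^sup>2 * u l * u k) *
      (if l = k then \<integral>\<omega>. g \<omega> * (p n l \<omega> * (1 - p n l \<omega>)) \<partial>M else 0))"
    by (simp only: integral_mult_right_zero expectation_mult_\<Delta>_\<Delta>[OF g])
  also have "\<dots> = (r n)\<^sup>2 * (\<Sum>l\<in>UNIV. (u l)\<^sup>2 * (\<integral>\<omega>. g \<omega> * (p n l \<omega> * (1 - p n l \<omega>)) \<partial>M))"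
    unfolding sum_distrib_left
    by (intro sum.cong refl) (simp add: if_distrib power2_eq_square mult_ac cong: if_cong)
  finally show ?thesis
    by (simp add: m_def)
qed

text \<open>The expected conditional variance of \<open>X (Suc n)\<close> at \<open>l\<close> given
  \<open>F n\<close>.\<close>

definition noise :: "nat \<Rightarrow> 'n \<Rightarrow> real" where
  "noise n l = (\<integral>\<omega>. p n l \<omega> * (1 - p n l \<omega>) \<partial>M)"

lemma p_var_nonneg: "\<omega> \<in> space M \<Longrightarrow> 0 \<le> p n l \<omega> * (1 - p n l \<omega>)"
  using p_range[of \<omega> n l] by simp

lemma noise_nonneg: "0 \<le> noise n l"
  unfolding noise_def by (rule Bochner_Integration.integral_nonneg) (rule p_var_nonneg)

section \<open>Energy balance and summability of the errors\<close>

lemma cdev_bounded_rv: "(\<lambda>\<omega>. cdev h (Z n \<omega>)) \<in> bounded_rv (F n)"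
  unfolding cdev_def by (intro bounded_rv_intros Z_bounded_rv_F)

lemma Q_bounded_rv: "(\<lambda>\<omega>. Q (Z n \<omega>)) \<in> bounded_rv (F n)"
  unfolding Q_def by (intro bounded_rv_intros cdev_bounded_rv)

lemma R_bounded_rv: "(\<lambda>\<omega>. R (Z n \<omega>)) \<in> bounded_rv (F n)"
  unfolding R_def by (intro bounded_rv_intros cdev_bounded_rv)

text \<open>\<open>second_moment_step\<close> with \<open>u = \<gamma> h\<close>, summed over the
  classes; the predictable parts follow the mixing \<open>cdev_mix\<close>, whose loss of energy is
  given by \<open>Q_mix\<close>.\<close>

lemma Q_step:
  assumes g: "g \<in> bounded_rv (F n)"
  shows "(\<integral>\<omega>. g \<omega> * Q (Z (Suc n) \<omega>) \<partial>M) =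
    (\<integral>\<omega>. g \<omega> * (Q (Z n \<omega>) - r n * (1 - r n) * R (Z n \<omega>)) \<partial>M) +
    (r n)\<^sup>2 * (\<Sum>h<d. \<Sum>l\<in>UNIV. (\<gamma> h l)\<^sup>2 * (\<integral>\<omega>. g \<omega> * (p n l \<omega> * (1 - p n l \<omega>)) \<partial>M))"
proof -
  note gM = bounded_rv_F_M[OF g]
  note cM = bounded_rv_F_M[OF cdev_bounded_rv]
  define V where "V h = (\<Sum>l\<in>UNIV. (\<gamma> h l)\<^sup>2 * (\<integral>\<omega>. g \<omega> * (p n l \<omega> * (1 - p n l \<omega>)) \<partial>M))" for h
  have mix: "(\<Sum>l\<in>UNIV. \<gamma> h l * ((1 - r n) * Z n \<omega> $ l + r n * p n l \<omega>)) =
      (1 - r n) * cdev h (Z n \<omega>) + r n * cdev (Suc h) (Z n \<omega>)" for h \<omega>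
    using cdev_mix[of h "r n" "Z n \<omega>"] by (simp add: cdev_def p_def)
  have "(\<integral>\<omega>. g \<omega> * Q (Z (Suc n) \<omega>) \<partial>M) = (\<integral>\<omega>. (\<Sum>h<d. g \<omega> * (cdev h (Z (Suc n) \<omega>))\<^sup>2) \<partial>M)"
    by (simp add: Q_def sum_distrib_left)
  also have "\<dots> = (\<Sum>h<d. \<integral>\<omega>. g \<omega> * (cdev h (Z (Suc n) \<omega>))\<^sup>2 \<partial>M)"
    by (intro Bochner_Integration.integral_sum integrable_bounded_rv rv_intros gM cM)
  also have "\<dots> = (\<Sum>h<d. (\<integral>\<omega>. g \<omega> * ((1 - r n) * cdev h (Z n \<omega>) + r n * cdev (Suc h) (Z n \<omega>))\<^sup>2 \<partial>M)
      + (r n)\<^sup>2 * V h)"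
    using second_moment_step[OF g, of "\<gamma> _"] unfolding mix V_def cdev_def[symmetric] by simp
  also have "\<dots> = (\<Sum>h<d. (\<integral>\<omega>. g \<omega> * ((1 - r n) * cdev h (Z n \<omega>) + r n * cdev (Suc h) (Z n \<omega>))\<^sup>2 \<partial>M))
      + (r n)\<^sup>2 * (\<Sum>h<d. V h)"
    by (simp add: sum.distrib sum_distrib_left)
  also have "(\<Sum>h<d. (\<integral>\<omega>. g \<omega> * ((1 - r n) * cdev h (Z n \<omega>) + r n * cdev (Suc h) (Z n \<omega>))\<^sup>2 \<partial>M)) =
      (\<integral>\<omega>. (\<Sum>h<d. g \<omega> * ((1 - r n) * cdev h (Z n \<omega>) + r n * cdev (Suc h) (Z n \<omega>))\<^sup>2) \<partial>M)"
    by (intro Bochner_Integration.integral_sum[symmetric] integrable_bounded_rv rv_intros gM cM)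
  also have "\<dots> = (\<integral>\<omega>. g \<omega> * (Q (Z n \<omega>) - r n * (1 - r n) * R (Z n \<omega>)) \<partial>M)"
    by (simp only: Q_mix flip: sum_distrib_left)
  finally show ?thesis
    by (simp add: V_def)
qed

text \<open>The weighted mean \<open>v \<bullet> Z n\<close> is a bounded martingale, so its increments are
  square summable. This controls the noise without any assumption on the sum of \<open>(r n)\<^sup>2\<close>.\<close>

lemma summable_noise: "summable (\<lambda>n. (r n)\<^sup>2 * noise n l)"
proof (rule summableI_nonneg_bounded)
  \<comment> \<open>The second moment of the martingale. With weights \<open>v\<close> the
    predictable part reproduces the mean itself, so each step adds exactly the weighted
    noise.\<close>
  define E where "E n = (\<integral>\<omega>. (\<Sum>l\<in>UNIV. v $ l * Z n \<omega> $ l)\<^sup>2 \<partial>M)" for n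
  have step: "E (Suc n) = E n + (r n)\<^sup>2 * (\<Sum>l\<in>UNIV. (v $ l)\<^sup>2 * noise n l)" for n
  proof -
    have "(\<Sum>l\<in>UNIV. v $ l * ((1 - r n) * Z n \<omega> $ l + r n * p n l \<omega>)) = (\<Sum>l\<in>UNIV. v $ l * Z n \<omega> $ l)" for \<omega>
    proof -
      have "(\<Sum>l\<in>UNIV. v $ l * ((1 - r n) * Z n \<omega> $ l + r n * p n l \<omega>)) =
          (1 - r n) * (\<Sum>l\<in>UNIV. v $ l * Z n \<omega> $ l) + r n * (\<Sum>l\<in>UNIV. v $ l * (A *v Z n \<omega>) $ l)"
        by (simp add: p_def distrib_left sum.distrib sum_distrib_left mult_ac)
      then show ?thesis
        by (simp add: sum_v_mult algebra_simps)
    qed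
    then show ?thesis
      using second_moment_step[OF bounded_rv_const[of 1], where n = n and u = "\<lambda>l. v $ l"] by (simp add: E_def noise_def)
  qed
  have E0: "0 \<le> E 0"
    unfolding E_def by simp
  have E1: "E n \<le> 1" for n
  proof -
    have "E n \<le> (\<integral>\<omega>. 1 \<partial>M)"
      unfolding E_def
    proof (rule integral_mono)
      show "integrable M (\<lambda>\<omega>. (\<Sum>l\<in>UNIV. v $ l * Z n \<omega> $ l)\<^sup>2)"
        by (intro integrable_bounded_rv rv_intros)
      fix \<omega> assume "\<omega> \<in> space M"
      then have "0 \<le> v $ l * Z n \<omega> $ l" "v $ l * Z n \<omega> $ l \<le> v $ l" for l
        using Z_range[of \<omega> n l] v_pos[of l] by (auto intro: mult_left_le)
      then have "0 \<le> (\<Sum>l\<in>UNIV. v $ l * Z n \<omega> $ l)" "(\<Sum>l\<in>UNIV. v $ l * Z n \<omega> $ l) \<le> 1"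
        using sum_mono[of UNIV "\<lambda>l. v $ l * Z n \<omega> $ l" "\<lambda>l. v $ l"] by (auto simp: sum_v sum_nonneg)
      then show "(\<Sum>l\<in>UNIV. v $ l * Z n \<omega> $ l)\<^sup>2 \<le> 1"
        by (rule power_le_one)
    qed simp
    then show ?thesis
      by (simp add: prob_space)
  qed
  have sum_E: "(\<Sum>n<N. (r n)\<^sup>2 * (\<Sum>l\<in>UNIV. (v $ l)\<^sup>2 * noise n l)) = E N - E 0" for N
    by (induction N) (simp_all add: step)
  show "0 \<le> (r n)\<^sup>2 * noise n l" for n
    by (simp add: noise_nonneg)
  \<comment> \<open>The noise at \<open>l\<close> is one of the non-negative summands, with weight
    \<open>(v $ l)\<^sup>2\<close>, of a total that telescopes to at most 1.\<close>
  show "(\<Sum>n<N. (r n)\<^sup>2 * noise n l) \<le> 1 / (v $ l)\<^sup>2" for N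
  proof -
    have "(v $ l)\<^sup>2 * (\<Sum>n<N. (r n)\<^sup>2 * noise n l) \<le> (\<Sum>n<N. (r n)\<^sup>2 * (\<Sum>l\<in>UNIV. (v $ l)\<^sup>2 * noise n l))"
      unfolding sum_distrib_left[of "(v $ l)\<^sup>2"]
    proof (rule sum_mono)
      fix n
      have "(v $ l)\<^sup>2 * noise n l \<le> (\<Sum>l\<in>UNIV. (v $ l)\<^sup>2 * noise n l)"
        by (rule member_le_sum) (auto simp: noise_nonneg)
      from mult_left_mono[OF this, of "(r n)\<^sup>2"]
      show "(v $ l)\<^sup>2 * ((r n)\<^sup>2 * noise n l) \<le> (r n)\<^sup>2 * (\<Sum>l\<in>UNIV. (v $ l)\<^sup>2 * noise n l)"
        by (simp add: mult_ac)
    qed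
    also have "\<dots> \<le> 1"
      using sum_E[of N] E0 E1[of N] by linarith
    finally show ?thesis
      using v_pos[of l] by (simp add: field_simps)
  qed
qed

definition err :: "nat \<Rightarrow> real" where
  "err n = (r n)\<^sup>2 * (\<Sum>h<d. \<Sum>l\<in>UNIV. (\<gamma> h l)\<^sup>2 * noise n l)"

lemma err_nonneg: "0 \<le> err n"
  by (simp add: err_def sum_nonneg noise_nonneg)

lemma summable_err: "summable err"
proof -
  have "summable (\<lambda>n. \<Sum>h<d. \<Sum>l\<in>UNIV. (\<gamma> h l)\<^sup>2 * ((r n)\<^sup>2 * noise n l))"
    by (intro summable_sum summable_mult summable_noise)
  then show ?thesis
    by (simp add: err_def[abs_def] sum_distrib_left mult_ac)
qed

lemma r_var_pos: "0 < r n * (1 - r n)"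
  using r_range[of n] by simp

text \<open>The dissipation is dropped and the noise on \<open>S\<close> is enlarged to the noise on
  the whole space, which yields the deterministic error of an almost supermartingale.\<close>

lemma Q_event_step:
  assumes "S \<in> sets (F n)"
  shows "(\<integral>\<omega>. indicator S \<omega> * Q (Z (Suc n) \<omega>) \<partial>M) \<le> (\<integral>\<omega>. indicator S \<omega> * Q (Z n \<omega>) \<partial>M) + err n"
proof -
  note S = bounded_rv_indicator[OF assms]
  note SM = bounded_rv_F_M[OF S] and QM = bounded_rv_F_M[OF Q_bounded_rv] and RM = bounded_rv_F_M[OF R_bounded_rv]
  have "(\<integral>\<omega>. indicator S \<omega> * (p n l \<omega> * (1 - p n l \<omega>)) \<partial>M) \<le> noise n l" for l
    unfolding noise_def
  proof (rule integral_mono)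
    fix \<omega> assume "\<omega> \<in> space M"
    then show "indicator S \<omega> * (p n l \<omega> * (1 - p n l \<omega>)) \<le> p n l \<omega> * (1 - p n l \<omega>)"
      using p_var_nonneg[of \<omega> n l] by (simp add: indicator_def)
  qed (intro integrable_bounded_rv rv_intros SM)+
  then have "(r n)\<^sup>2 * (\<Sum>h<d. \<Sum>l\<in>UNIV. (\<gamma> h l)\<^sup>2 * (\<integral>\<omega>. indicator S \<omega> * (p n l \<omega> * (1 - p n l \<omega>)) \<partial>M)) \<le> err n"
    unfolding err_def by (intro mult_left_mono sum_mono) auto
  moreover have "(\<integral>\<omega>. indicator S \<omega> * (Q (Z n \<omega>) - r n * (1 - r n) * R (Z n \<omega>)) \<partial>M) \<le>
      (\<integral>\<omega>. indicator S \<omega> * Q (Z n \<omega>) \<partial>M)"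
  proof (rule integral_mono)
    fix \<omega>
    have "0 \<le> r n * (1 - r n) * R (Z n \<omega>)"
      using less_imp_le[OF r_var_pos] R_nonneg by (rule mult_nonneg_nonneg)
    then show "indicator S \<omega> * (Q (Z n \<omega>) - r n * (1 - r n) * R (Z n \<omega>)) \<le> indicator S \<omega> * Q (Z n \<omega>)"
      by (intro mult_left_mono) auto
  qed (intro integrable_bounded_rv rv_intros SM QM RM)+
  ultimately show ?thesis
    using Q_step[OF S] by simp
qed

section \<open>Two-sided recursion for the mean energy\<close>

definition mean_Q :: "nat \<Rightarrow> real" where
  "mean_Q n = (\<integral>\<omega>. Q (Z n \<omega>) \<partial>M)"

lemma mean_Q_nonneg: "0 \<le> mean_Q n"
  unfolding mean_Q_def by (simp add: Q_nonneg)

lemma mean_Q_Suc: "mean_Q (Suc n) = mean_Q n - r n * (1 - r n) * (\<integral>\<omega>. R (Z n \<omega>) \<partial>M) + err n"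
proof -
  have "(\<integral>\<omega>. Q (Z n \<omega>) - r n * (1 - r n) * R (Z n \<omega>) \<partial>M) = mean_Q n - (\<integral>\<omega>. r n * (1 - r n) * R (Z n \<omega>) \<partial>M)"
    unfolding mean_Q_def
    by (intro Bochner_Integration.integral_diff integrable_bounded_rv rv_intros
        bounded_rv_F_M[OF Q_bounded_rv] bounded_rv_F_M[OF R_bounded_rv])
  then show ?thesis
    using Q_step[OF bounded_rv_const[of 1], where n = n] by (simp add: mean_Q_def err_def noise_def)
qed

lemma mean_Q_upper: "mean_Q (Suc n) \<le> mean_Q n - r n * (1 - r n) * (mean_Q n / d\<^sup>2) + err n"
proof -
  have "mean_Q n \<le> (\<integral>\<omega>. d\<^sup>2 * R (Z n \<omega>) \<partial>M)"
    unfolding mean_Q_def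
    by (intro integral_mono Q_le_R integrable_bounded_rv rv_intros
        bounded_rv_F_M[OF Q_bounded_rv] bounded_rv_F_M[OF R_bounded_rv])
  then have "mean_Q n / d\<^sup>2 \<le> (\<integral>\<omega>. R (Z n \<omega>) \<partial>M)"
    using d_pos by (simp add: field_simps)
  then have "r n * (1 - r n) * (mean_Q n / d\<^sup>2) \<le> r n * (1 - r n) * (\<integral>\<omega>. R (Z n \<omega>) \<partial>M)"
    using r_var_pos[of n] by (intro mult_left_mono) auto
  then show ?thesis
    unfolding mean_Q_Suc by simp
qed

text \<open>The error is kept as a separate summand, because the later positivity of the mean energy
  rests on it.\<close>

lemma mean_Q_lower: "(1 - 4 * (r n * (1 - r n))) * mean_Q n + err n \<le> mean_Q (Suc n)"
proof -
  have "(\<integral>\<omega>. R (Z n \<omega>) \<partial>M) \<le> (\<integral>\<omega>. 4 * Q (Z n \<omega>) \<partial>M)"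
    by (intro integral_mono R_le integrable_bounded_rv rv_intros
        bounded_rv_F_M[OF Q_bounded_rv] bounded_rv_F_M[OF R_bounded_rv])
  then have "(\<integral>\<omega>. R (Z n \<omega>) \<partial>M) \<le> 4 * mean_Q n"
    by (simp add: mean_Q_def)
  then have "r n * (1 - r n) * (\<integral>\<omega>. R (Z n \<omega>) \<partial>M) \<le> r n * (1 - r n) * (4 * mean_Q n)"
    using r_var_pos[of n] by (intro mult_left_mono) auto
  then show ?thesis
    unfolding mean_Q_Suc by (simp add: algebra_simps)
qed

text \<open>If the mean energy stayed above \<open>\<delta>\<close>, each step would dissipate at
  least \<open>r n * (1 - r n) * (\<delta> / d\<^sup>2)\<close>. These losses add up without bound,
  while only the energy at time \<open>k\<close> and the finite total of the errors can pay for
  them.\<close>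

lemma mean_Q_small:
  assumes div: "filterlim (\<lambda>n. \<Sum>k<n. r k * (1 - r k)) at_top sequentially" and "0 < \<delta>"
  shows "\<exists>m\<ge>k. mean_Q m < \<delta>"
proof (rule ccontr)
  assume "\<not> ?thesis"
  then have ge: "\<delta> \<le> mean_Q m" if "k \<le> m" for m
    using that by (auto simp: not_less)
  define s where "s n = (\<Sum>j<n. r j * (1 - r j))" for n
  define C where "C = suminf err"
  \<comment> \<open>Errors are counted from time 0 instead of \<open>k\<close>; being non-negative,
    the extra ones only weaken the bound.\<close>
  have main: "mean_Q n + (\<delta> / d\<^sup>2) * (s n - s k) \<le> mean_Q k + (\<Sum>j<n. err j)" if "k \<le> n" for n
    using that
  proof (induction n rule: dec_induct)
    case base
    then show ?case by (simp add: sum_nonneg err_nonneg)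
  next
    case (step n)
    have "r n * (1 - r n) * (\<delta> / d\<^sup>2) \<le> r n * (1 - r n) * (mean_Q n / d\<^sup>2)"
      using ge[OF step.hyps(1)] r_var_pos[of n] by (intro mult_left_mono divide_right_mono) auto
    moreover have "(\<delta> / d\<^sup>2) * (s (Suc n) - s k) = (\<delta> / d\<^sup>2) * (s n - s k) + r n * (1 - r n) * (\<delta> / d\<^sup>2)"
      unfolding s_def sum.lessThan_Suc by (simp only: algebra_simps)
    ultimately show ?case
      using step.IH mean_Q_upper[of n] by simp
  qed
  have err_le: "(\<Sum>j<n. err j) \<le> C" for n
    unfolding C_def by (rule sum_le_suminf[OF summable_err]) (auto simp: err_nonneg)
  have bd: "(\<delta> / d\<^sup>2) * (s n - s k) \<le> mean_Q k + C" if "k \<le> n" for n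
    using main[OF that] err_le[of n] mean_Q_nonneg[of n] by linarith
  have pos: "0 < \<delta> / d\<^sup>2"
    using \<open>0 < \<delta>\<close> d_pos by simp
  have bd': "s n \<le> (mean_Q k + C) / (\<delta> / d\<^sup>2) + s k" if "k \<le> n" for n
    using bd[OF that] pos_le_divide_eq[OF pos, of "s n - s k" "mean_Q k + C"] by (simp add: mult.commute)
  have "\<forall>\<^sub>F n in sequentially. (mean_Q k + C) / (\<delta> / d\<^sup>2) + s k + 1 \<le> s n"
    using div unfolding filterlim_at_top s_def by blast
  then have "\<forall>\<^sub>F n in sequentially. False"
    using eventually_ge_at_top[of k]
  proof eventually_elim
    case (elim n)
    then show ?case using bd'[of n] by linarith
  qed
  then show False by simp
qed

lemma AE_Q_tendsto_0:
  assumes "filterlim (\<lambda>n. \<Sum>k<n. r k * (1 - r k)) at_top sequentially"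
  shows "AE \<omega> in M. (\<lambda>n. Q (Z n \<omega>)) \<longlonglongrightarrow> 0"
proof (rule almost_supermartingale_tendsto_0[where F = F and e = err])
  show "\<exists>m\<ge>k. expectation (\<lambda>\<omega>. Q (Z m \<omega>)) < \<delta>" if "0 < \<delta>" for \<delta> k
    using mean_Q_small[OF assms that] by (simp add: mean_Q_def)
qed (use subalgebra_F sets_F_mono Q_event_step summable_err err_nonneg Q_nonneg
      bounded_rv_measurable[OF Q_bounded_rv] integrable_bounded_rv[OF bounded_rv_F_M[OF Q_bounded_rv]] in blast)+

section \<open>Positivity of the noise after time 0\<close>

lemma AE_p_binary:
  assumes "noise n l = 0"
  shows "AE \<omega> in M. p n l \<omega> = 0 \<or> p n l \<omega> = 1"
proof -
  have "AE \<omega> in M. p n l \<omega> * (1 - p n l \<omega>) = 0"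
    using assms unfolding noise_def
    by (subst integral_nonneg_eq_0_iff_AE[symmetric])
       (auto intro!: integrable_bounded_rv rv_intros simp: p_var_nonneg)
  then show ?thesis
    by (rule AE_mp) auto
qed

text \<open>The noise is also the second moment of the innovation, so without noise the actions
  agree with their conditional means.\<close>

lemma AE_X_eq_p:
  assumes "noise n l = 0"
  shows "AE \<omega> in M. X (Suc n) \<omega> $ l = p n l \<omega>"
proof -
  have "(\<integral>\<omega>. (\<Delta> n l \<omega>)\<^sup>2 \<partial>M) = 0"
    using expectation_mult_\<Delta>_\<Delta>[OF bounded_rv_const[of 1], where n = n and l = l and k = l] assms
    by (simp add: noise_def power2_eq_square)
  then have "AE \<omega> in M. (\<Delta> n l \<omega>)\<^sup>2 = 0"
    by (subst integral_nonneg_eq_0_iff_AE[symmetric]) (auto intro!: integrable_bounded_rv rv_intros)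
  then show ?thesis
    by (rule AE_mp) auto
qed

text \<open>Every step keeps a positive share of the old state in the unit interval, so an entry can
  be 0 or 1 only if it was so before. This carries constancy back to time 0, where it is restricted
  by assumption.\<close>

lemma Z_const_backwards:
  assumes "\<omega> \<in> space M"
  shows "Z n \<omega> = 0 \<Longrightarrow> Z 0 \<omega> = 0" "Z n \<omega> = 1 \<Longrightarrow> Z 0 \<omega> = 1"
proof -
  have down: "Z n \<omega> $ l = 0" if "Z (Suc n) \<omega> $ l = 0" for n l
  proof -
    have "(1 - r n) * Z n \<omega> $ l + r n * X (Suc n) \<omega> $ l = 0"
      using that Z_step[OF assms, of n] by simp
    moreover have "0 \<le> (1 - r n) * Z n \<omega> $ l" "0 \<le> r n * X (Suc n) \<omega> $ l"
      using Z_range[OF assms, of n l] X_range[OF assms, of n l] r_range[of n] by auto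
    ultimately have "(1 - r n) * Z n \<omega> $ l = 0"
      by linarith
    then show ?thesis
      using r_range[of n] by simp
  qed
  have up: "Z n \<omega> $ l = 1" if "Z (Suc n) \<omega> $ l = 1" for n l
  proof -
    have "(1 - r n) * (1 - Z n \<omega> $ l) + r n * (1 - X (Suc n) \<omega> $ l) = 0"
      using that Z_step[OF assms, of n] by (simp add: algebra_simps)
    moreover have "0 \<le> (1 - r n) * (1 - Z n \<omega> $ l)" "0 \<le> r n * (1 - X (Suc n) \<omega> $ l)"
      using Z_range[OF assms, of n l] X_range[OF assms, of n l] r_range[of n] by auto
    ultimately have "(1 - r n) * (1 - Z n \<omega> $ l) = 0"
      by linarith
    then show ?thesis
      using r_range[of n] by simp
  qed
  show "Z n \<omega> = 0 \<Longrightarrow> Z 0 \<omega> = 0"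
    by (induction n) (use down in \<open>simp_all add: vec_eq_iff\<close>)
  show "Z n \<omega> = 1 \<Longrightarrow> Z 0 \<omega> = 1"
    by (induction n) (use up in \<open>simp_all add: vec_eq_iff\<close>)
qed

text \<open>Two consecutive vanishing noise terms would force the network into a random state that is
  \<open>0\<close>-\<open>1\<close>-valued, frozen, and fixed by \<open>A\<close>, hence constant; this is where the
  non-triviality of \<open>Z 0\<close> enters.\<close>

lemma ex_noise_pos: "\<exists>l. 0 < noise (Suc k) l"
proof (rule ccontr)
  assume "\<not> ?thesis"
  then have noise0: "noise (Suc k) l = 0" for l
    using noise_nonneg[of "Suc k" l] by (auto simp: not_less intro: antisym)
  have "AE \<omega> in M. \<forall>l\<in>UNIV. p (Suc k) l \<omega> = 0 \<or> p (Suc k) l \<omega> = 1"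
    by (intro AE_finite_allI AE_p_binary noise0) simp
  \<comment> \<open>The binary conditional means make \<open>Z (Suc k)\<close> binary, and a strict
    convex combination that is binary has equal components.\<close>
  then have frozen: "AE \<omega> in M. Z k \<omega> = Z (Suc k) \<omega> \<and> X (Suc k) \<omega> = Z (Suc k) \<omega> \<and>
      (\<forall>j. Z k \<omega> $ j = 0 \<or> Z k \<omega> $ j = 1) \<and> (\<forall>l. p k l \<omega> = 0 \<or> p k l \<omega> = 1)"
  proof (rule AE_mp, intro AE_I2 impI)
    fix \<omega> assume \<omega>: "\<omega> \<in> space M" and bin: "\<forall>l\<in>UNIV. p (Suc k) l \<omega> = 0 \<or> p (Suc k) l \<omega> = 1"
    have ZS: "Z (Suc k) \<omega> $ j = 0 \<or> Z (Suc k) \<omega> $ j = 1" for j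
      by (rule binary_of_binary_mult) (use Z_range[OF \<omega>] bin in \<open>auto simp: p_def\<close>)
    have eq: "Z k \<omega> $ j = Z (Suc k) \<omega> $ j" "X (Suc k) \<omega> $ j = Z (Suc k) \<omega> $ j" for j
      using convex_comb_binary[of "r k" "Z k \<omega> $ j" "X (Suc k) \<omega> $ j" "Z (Suc k) \<omega> $ j"]
        r_range[of k] Z_range[OF \<omega>, of k j] X_range[OF \<omega>, of k j] ZS[of j] Z_step[OF \<omega>, of k]
      by auto
    then have ZZ: "Z k \<omega> = Z (Suc k) \<omega>" "X (Suc k) \<omega> = Z (Suc k) \<omega>"
      by (auto simp: vec_eq_iff)
    show "Z k \<omega> = Z (Suc k) \<omega> \<and> X (Suc k) \<omega> = Z (Suc k) \<omega> \<and>
      (\<forall>j. Z k \<omega> $ j = 0 \<or> Z k \<omega> $ j = 1) \<and> (\<forall>l. p k l \<omega> = 0 \<or> p k l \<omega> = 1)"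
      using ZZ ZS bin by (simp add: p_def)
  qed
  \<comment> \<open>The state did not move, so the conditional means at time \<open>k\<close> are
    binary as well.\<close>
  have noise0': "noise k l = 0" for l
  proof -
    have "AE \<omega> in M. p k l \<omega> * (1 - p k l \<omega>) = 0"
      using frozen by (rule AE_mp) auto
    then show ?thesis
      unfolding noise_def by (rule integral_eq_zero_AE)
  qed
  have "AE \<omega> in M. \<forall>l\<in>UNIV. X (Suc k) \<omega> $ l = p k l \<omega>"
    by (intro AE_finite_allI AE_X_eq_p noise0') simp
  \<comment> \<open>Now \<open>A *v Z k\<close> equals \<open>X (Suc k)\<close> by the absence of
    noise and \<open>X (Suc k)\<close> equals \<open>Z k\<close> by freezing, so the binary state is
    a fixed point.\<close>
  with frozen AE_space have const: "AE \<omega> in M. Z 0 \<omega> = 0 \<or> Z 0 \<omega> = 1"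
  proof eventually_elim
    case (elim \<omega>)
    then have "A *v Z k \<omega> = Z k \<omega>"
      by (simp add: vec_eq_iff p_def)
    then have "Z k \<omega> = 0 \<or> Z k \<omega> = 1"
      using elim by (intro binary_fixpoint_const) auto
    then show ?case
      using Z_const_backwards[of \<omega> k] elim by blast
  qed
  let ?S = "\<lambda>a. {\<omega> \<in> space M. Z 0 \<omega> = a}"
  have S: "?S a \<in> events" for a
    using measurable_sets[OF Z0_measurable, of "{a}"] by (simp add: vimage_def Int_def conj_commute)
  have "prob (?S 0 \<union> ?S 1) = 1"
    using const S by (subst prob_eq_1) auto
  moreover have "prob (?S 0 \<union> ?S 1) \<le> prob (?S 0) + prob (?S 1)"
    by (intro measure_Un_le S)
  ultimately show False
    using Z0_nontrivial by linarith
qed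

text \<open>The index starts at 1: if \<open>Z 0\<close> is the indicator of a single cyclic class,
  the conditional means at time 0 are binary and the first error vanishes.\<close>

lemma err_pos:
  assumes "2 \<le> d"
  shows "0 < err (Suc k)"
proof -
  obtain l where l: "0 < noise (Suc k) l"
    using ex_noise_pos by blast
  obtain h where h: "h < d" "\<gamma> h l \<noteq> 0"
    using \<gamma>_nonzero[OF assms] by blast
  have "0 < (\<gamma> h l)\<^sup>2 * noise (Suc k) l"
    using l h by simp
  also have "\<dots> \<le> (\<Sum>l\<in>UNIV. (\<gamma> h l)\<^sup>2 * noise (Suc k) l)"
    by (rule member_le_sum) (auto simp: noise_nonneg)
  also have "\<dots> \<le> (\<Sum>h<d. \<Sum>l\<in>UNIV. (\<gamma> h l)\<^sup>2 * noise (Suc k) l)"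
    using h by (intro member_le_sum[of h "{..<d}" "\<lambda>h. \<Sum>l\<in>UNIV. (\<gamma> h l)\<^sup>2 * noise (Suc k) l"])
      (auto simp: noise_nonneg sum_nonneg)
  finally show ?thesis
    using r_range[of "Suc k"] by (simp add: err_def)
qed

lemma mean_Q_pos:
  assumes "2 \<le> d"
  shows "0 < mean_Q (Suc (Suc k))"
proof -
  \<comment> \<open>This square is the retained fraction \<open>1 - 4 * r * (1 - r)\<close> of the
    lower recursion. It vanishes for \<open>r = 1 / 2\<close>, so strict positivity comes from the
    error.\<close>
  have "0 \<le> (1 - 2 * r (Suc k))\<^sup>2"
    by simp
  then have "0 \<le> 1 - 4 * (r (Suc k) * (1 - r (Suc k)))"
    by (simp add: power2_eq_square algebra_simps)
  then have "0 \<le> (1 - 4 * (r (Suc k) * (1 - r (Suc k)))) * mean_Q (Suc k)"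
    by (intro mult_nonneg_nonneg mean_Q_nonneg)
  then show ?thesis
    using mean_Q_lower[of "Suc k"] err_pos[OF assms, of k] by linarith
qed

section \<open>The case of a convergent sum, and the equivalence\<close>

lemma Q_le_const:
  assumes "\<omega> \<in> space M"
  shows "Q (Z n \<omega>) \<le> (\<Sum>h<d. (\<Sum>l\<in>UNIV. \<bar>\<gamma> h l\<bar>)\<^sup>2)"
  unfolding Q_def
proof (rule sum_mono)
  fix h
  have "\<bar>cdev h (Z n \<omega>)\<bar> \<le> (\<Sum>l\<in>UNIV. \<bar>\<gamma> h l * Z n \<omega> $ l\<bar>)"
    unfolding cdev_def by (rule sum_abs)
  also have "\<dots> \<le> (\<Sum>l\<in>UNIV. \<bar>\<gamma> h l\<bar>)"
    using Z_range[OF assms] by (intro sum_mono) (simp add: abs_mult mult_left_le)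
  finally have "\<bar>cdev h (Z n \<omega>)\<bar>\<^sup>2 \<le> (\<Sum>l\<in>UNIV. \<bar>\<gamma> h l\<bar>)\<^sup>2"
    by (intro power_mono) auto
  then show "(cdev h (Z n \<omega>))\<^sup>2 \<le> (\<Sum>l\<in>UNIV. \<bar>\<gamma> h l\<bar>)\<^sup>2"
    by simp
qed

text \<open>Dominated convergence: states in the unit cube have uniformly bounded energy.\<close>

lemma mean_Q_tendsto_0:
  assumes "AE \<omega> in M. (\<lambda>n. Q (Z n \<omega>)) \<longlonglongrightarrow> 0"
  shows "mean_Q \<longlonglongrightarrow> 0"
proof -
  have "(\<lambda>n. \<integral>\<omega>. Q (Z n \<omega>) \<partial>M) \<longlonglongrightarrow> (\<integral>\<omega>. 0 \<partial>M)"
  proof (rule integral_dominated_convergence)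
    show "AE \<omega> in M. norm (Q (Z n \<omega>)) \<le> (\<Sum>h<d. (\<Sum>l\<in>UNIV. \<bar>\<gamma> h l\<bar>)\<^sup>2)" for n
      by (rule AE_I2) (simp add: Q_nonneg Q_le_const)
  qed (use assms bounded_rv_measurable[OF bounded_rv_F_M[OF Q_bounded_rv]] in auto)
  then show ?thesis
    by (simp add: mean_Q_def[abs_def])
qed

text \<open>With a convergent sum, the retained fractions after a late time \<open>m\<close> have
  products at least 1/2, so the mean energy never falls below half of its positive value at
  \<open>m\<close> and cannot tend to zero.\<close>

lemma not_summable_of_AE_tendsto:
  assumes d: "2 \<le> d" and lim: "AE \<omega> in M. (\<lambda>n. Q (Z n \<omega>)) \<longlonglongrightarrow> 0"
  shows "\<not> summable (\<lambda>n. r n * (1 - r n))"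
proof
  define t where "t n = r n * (1 - r n)" for n
  assume "summable (\<lambda>n. r n * (1 - r n))"
  then have t: "summable t"
    by (simp add: t_def[abs_def])
  have t_nonneg: "0 \<le> t n" for n
    using r_var_pos[of n] by (simp add: t_def)
  \<comment> \<open>A tail below 1/8 leaves \<open>1 - 4 * (1 / 8) = 1 / 2\<close> in the product
    bound below.\<close>
  have "\<forall>\<^sub>F m in sequentially. (\<Sum>k. t (k + m)) < 1 / 8"
    by (intro order_tendstoD(2)[OF suminf_exist_split2[OF t]]) simp
  then obtain m0 where m0: "\<And>m. m0 \<le> m \<Longrightarrow> (\<Sum>k. t (k + m)) < 1 / 8"
    unfolding eventually_sequentially by blast
  \<comment> \<open>The shift by two reaches the times at which \<open>mean_Q_pos\<close>
    applies.\<close>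
  have tail: "(\<Sum>k. t (k + Suc (Suc m0))) < 1 / 8"
    by (rule m0) simp
  define m where "m = Suc (Suc m0)"
  have partial: "(\<Sum>i<j. t (i + m)) \<le> 1 / 8" for j
    using sum_le_suminf[of "\<lambda>k. t (k + m)" "{..<j}"] tail t_nonneg summable_ignore_initial_segment[OF t, of m]
    by (simp add: m_def)
  have lower: "(1 - 4 * (\<Sum>i<j. t (i + m))) * mean_Q m \<le> mean_Q (j + m)" for j
  proof (induction j)
    case (Suc j)
    define a b where "a = 4 * t (j + m)" and "b = 4 * (\<Sum>i<j. t (i + m))"
    have b: "0 \<le> b"
      by (simp add: b_def sum_nonneg t_nonneg)
    have a: "0 \<le> a" "a \<le> 1"
      using partial[of "Suc j"] t_nonneg b by (auto simp: a_def b_def)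
    \<comment> \<open>The product inequality \<open>(1 - a) * (1 - b) \<ge> 1 - (a + b)\<close> for
      non-negative \<open>a\<close> and \<open>b\<close> turns products of retained fractions into
      sums.\<close>
    have "(1 - (b + a)) * mean_Q m \<le> ((1 - a) * (1 - b)) * mean_Q m"
      using a b by (intro mult_right_mono mean_Q_nonneg) (simp add: algebra_simps)
    also have "\<dots> \<le> (1 - a) * mean_Q (j + m)"
      using Suc.IH a by (simp add: b_def mult_left_mono mult.assoc)
    also have "\<dots> \<le> mean_Q (Suc j + m)"
      using mean_Q_lower[of "j + m"] err_nonneg[of "j + m"] by (simp add: a_def t_def)
    finally show ?case
      by (simp add: a_def b_def distrib_left)
  qed simp
  have "mean_Q m / 2 \<le> mean_Q (j + m)" for j
  proof -
    have "1 / 2 * mean_Q m \<le> (1 - 4 * (\<Sum>i<j. t (i + m))) * mean_Q m"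
      using partial[of j] by (intro mult_right_mono mean_Q_nonneg) auto
    then show ?thesis
      using lower[of j] by simp
  qed
  then have "mean_Q m / 2 \<le> 0"
    using LIMSEQ_le_const[OF LIMSEQ_ignore_initial_segment[OF mean_Q_tendsto_0[OF lim], of m]] by blast
  then show False
    using mean_Q_pos[OF d, of m0] by (simp add: m_def)
qed

lemma AE_Z_2_tendsto_iff:
  assumes "2 \<le> d"
  shows "(AE \<omega> in M. (\<lambda>n. Z_2 A v (Z n \<omega>)) \<longlonglongrightarrow> 0) \<longleftrightarrow>
    filterlim (\<lambda>n. \<Sum>k<n. r k * (1 - r k)) at_top sequentially"
proof
  assume "AE \<omega> in M. (\<lambda>n. Z_2 A v (Z n \<omega>)) \<longlonglongrightarrow> 0"
  then have "\<not> summable (\<lambda>n. r n * (1 - r n))"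
    unfolding tendsto_Z_2_iff by (rule not_summable_of_AE_tendsto[OF assms])
  then show "filterlim (\<lambda>n. \<Sum>k<n. r k * (1 - r k)) at_top sequentially"
    by (intro filterlim_sum_at_top_of_not_summable less_imp_le r_var_pos)
next
  assume "filterlim (\<lambda>n. \<Sum>k<n. r k * (1 - r k)) at_top sequentially"
  then show "AE \<omega> in M. (\<lambda>n. Z_2 A v (Z n \<omega>)) \<longlonglongrightarrow> 0"
    unfolding tendsto_Z_2_iff by (rule AE_Q_tendsto_0)
qed

end

theorem theorem2p4:
  fixes W :: "real ^ 'n ^ 'n"
    and r :: "nat \<Rightarrow> real"
    and M :: "'a measure"
    and X Z :: "nat \<Rightarrow> 'a \<Rightarrow> real ^ 'n"
    and v :: "real ^ 'n"
  assumes N_ge_2: "CARD('n) \<ge> 2"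
    and W_nonneg: "nonneg_mat W"
    and W_irreducible: "irreducible_mat W"
    and W_stochastic: "transpose W *v 1 = 1"
    and r_range: "\<And>n. 0 < r n \<and> r n < 1"
    and prob: "prob_space M"
    and Z0_measurable: "Z 0 \<in> borel_measurable M"
    and Z0_range: "\<And>\<omega> l. \<omega> \<in> space M \<Longrightarrow> 0 \<le> Z 0 \<omega> $ l \<and> Z 0 \<omega> $ l \<le> 1"
    and Z0_nontrivial:
      "measure M {\<omega> \<in> space M. Z 0 \<omega> = 0} + measure M {\<omega> \<in> space M. Z 0 \<omega> = 1} < 1"
    and X_measurable: "\<And>n. X (Suc n) \<in> borel_measurable M"
    and X_range: "\<And>n \<omega> l. \<omega> \<in> space M \<Longrightarrow> X (Suc n) \<omega> $ l \<in> {0, 1}"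
    and X_cond_indep:
      "\<And>n. cond_indep_vars M (history M (Z 0) X n) (\<lambda>l \<omega>. X (Suc n) \<omega> $ l)"
    and X_cond_prob:
      "\<And>n l. AE \<omega> in M. cprob M (history M (Z 0) X n) {\<eta> \<in> space M. X (Suc n) \<eta> $ l = 1} \<omega>
                         = (\<Sum>l1\<in>UNIV. W $ l1 $ l * Z n \<omega> $ l1)"
    and Z_step:
      "\<And>n \<omega>. \<omega> \<in> space M \<Longrightarrow> Z (Suc n) \<omega> = (1 - r n) *\<^sub>R Z n \<omega> + r n *\<^sub>R X (Suc n) \<omega>"
    and v_pos: "\<And>l. 0 < v $ l"
    and v_eigen: "v v* transpose W = v"
    and v_sum: "v \<bullet> 1 = 1"
  shows "(period (transpose W) = 1 \<longrightarrow>
            (\<forall>n. \<forall>\<omega>\<in>space M. Z_2 (transpose W) v (Z n \<omega>) = 0)) \<and>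
         (period (transpose W) \<ge> 2 \<longrightarrow>
            ((AE \<omega> in M. (\<lambda>n. Z_2 (transpose W) v (Z n \<omega>)) \<longlonglongrightarrow> 0) \<longleftrightarrow>
             filterlim (\<lambda>n. \<Sum>k<n. r k * (1 - r k)) at_top sequentially))"
proof -
  have A: "nonneg_mat (transpose W)" "irreducible_mat (transpose W)"
    using W_nonneg W_irreducible by (simp_all add: nonneg_mat_transpose irreducible_mat_transpose)
  \<comment> \<open>Any numbering serves: neither \<open>Z_2\<close> nor \<open>period\<close>
    refers to it.\<close>
  obtain c where c: "cyclic_numbering (transpose W) c"
    using ex_cyclic_numbering[OF A] by blast
  interpret stochastic_cycle "transpose W" v c
    by unfold_locales (fact A W_stochastic v_pos v_eigen v_sum c)+
  have "(transpose W *v z) $ l = (\<Sum>l1\<in>UNIV. W $ l1 $ l * z $ l1)" for z l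
    unfolding matrix_vector_mult_def transpose_def by simp
  then have cond_prob: "AE \<omega> in M. cprob M (history M (Z 0) X n) {\<eta> \<in> space M. X (Suc n) \<eta> $ l = 1} \<omega>
      = (transpose W *v Z n \<omega>) $ l" for n l
    using X_cond_prob by presburger
  have r: "0 < r n" "r n < 1" for n
    using r_range by auto
  interpret prob_space M
    by (rule prob)
  interpret reinforced_network "transpose W" v c M r X Z
    by unfold_locales (fact r Z0_measurable Z0_range Z0_nontrivial X_measurable X_range X_cond_indep
        cond_prob Z_step)+
  have "Z_2 (transpose W) v z = 0" if "period (transpose W) = 1" for z
  proof -
    have "d = 1"
      using that by (simp add: d_def)
    \<comment> \<open>With a single class the class mean is the overall mean, so the weights cancel
      for every state, not only along the process.\<close>
    then have "\<gamma> h l = 0" for h l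
      using c_less[of l] by (simp add: \<gamma>_def)
    then show ?thesis
      by (simp add: vec_eq_iff Z_2_nth cdev_def)
  qed
  then show ?thesis
    using AE_Z_2_tendsto_iff by (simp add: d_def)
qed

end
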